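(* For every finite monoid $M$ and every odd integer $g\geq 7$ there exist infinitely many regular graphs $G$ of odd girth $g$ such that the endomorphism monoid $\mathrm{End}(G)$ is isomorphic to $M$.
   Context: All graphs are finite, simple and undirected. An endomorphism of $G$ is a map $V(G)\to V(G)$ sending edges to edges; $\mathrm{End}(G)$ is the monoid of endomorphisms under composition. The odd girth of a graph is the length of its shortest odd cycle. *)

theory Defs
  imports "Graph_Theory.Graph_Theory" "HOL-Algebra.Group" "HOL-Library.Extended_Nat"
begin

text \<open>
  Finite simple undirected graphs are rendered by the locale \<^locale>\<open>pair_graph\<close>: finite
  loop-free digraphs with a symmetric arc relation, each edge being represented by its two
  orientations. The definitions below are intended for such graphs.
\<close>

text \<open>
  The degree of a vertex of an undirected graph is the number of arcs leaving it.
\<close>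

definition regular_graph :: "'v pair_pre_digraph \<Rightarrow> bool" where
  "regular_graph G \<longleftrightarrow> (\<exists>k. \<forall>v \<in> pverts G. out_degree (with_proj G) v = k)"

text \<open>
  \<^const>\<open>pre_digraph.cycle\<close> also accepts the closed walk \<open>u, v, u\<close> along a single edge, but its
  length is even; since there are no loops, the cycles of odd length are exactly the odd cycles
  of the undirected graph. The odd girth of a bipartite graph is \<open>\<infinity>\<close>.
\<close>

definition odd_girth :: "'v pair_pre_digraph \<Rightarrow> enat" where
  "odd_girth G = (INF p \<in> {p. pre_digraph.cycle (with_proj G) p \<and> odd (length p)}. enat (length p))"

text \<open>
  Endomorphisms are extensional functions, so that each map on the vertex set is represented by
  exactly one HOL function.
\<close>

definition graph_endos :: "'v pair_pre_digraph \<Rightarrow> ('v \<Rightarrow> 'v) set" where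
  "graph_endos G =
     {f \<in> pverts G \<rightarrow>\<^sub>E pverts G. \<forall>u v. (u, v) \<in> parcs G \<longrightarrow> (f u, f v) \<in> parcs G}"

definition End_monoid :: "'v pair_pre_digraph \<Rightarrow> ('v \<Rightarrow> 'v) monoid" where
  "End_monoid G =
     \<lparr>carrier = graph_endos G, mult = compose (pverts G), one = (\<lambda>v \<in> pverts G. v)\<rparr>"

lemma monoid_End_monoid:
  assumes "pair_wf_digraph G"
  shows "monoid (End_monoid G)"
proof -
  interpret pair_wf_digraph G by fact
  show ?thesis
    by (rule monoidI)
      (auto simp: End_monoid_def graph_endos_def compose_def PiE_iff extensional_def fun_eq_iff
        dest: in_arcsD1 in_arcsD2)
qed

end

theory Submission
  imports Defs
begin

text \<open>
  The building blocks are copies of a rigid graph: a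
  subdivided wheel on three rim vertices whose spokes have lengths 1, 2, 3 and whose three faces
  are \<open>g\<close>-cycles; the rim has length \<open>3 g - 12\<close>, which exceeds \<open>g\<close> exactly when \<open>g \<ge> 7\<close>.
  Two copies of the wheel, lying on opposite sides of a bipartition of the copies, are joined by
  soft edges, which only connect equal vertices of the wheel. A closed walk crosses an even number
  of soft edges, so deleting these steps leaves an odd closed walk of the wheel: the odd girth is
  still \<open>g\<close>, and \<open>g\<close>-cycles stay inside copies. Hence every endomorphism permutes and identifies
  copies while being the identity on wheel vertices, and it acts on the index set as an
  endomorphism of a family of bipartite graphs, one for each vertex of the wheel.
  Choosing these bipartite graphs regular of complementary degree makes the whole graph regular.

  The monoid is encoded in these bipartite graphs by cells \<open>(x, y, m, l)\<close>. One relation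
  links \<open>(x, y, \<dots>)\<close> to all \<open>(y, y', \<dots>)\<close>, so that endomorphisms act on the first two coordinates
  by one and the same map \<open>h\<close>. The labels \<open>l\<close> of a triple \<open>(x, y, m)\<close> carry two permutations. If
  \<open>y \<noteq> x m\<close> they form a connected system \<open>E0\<close>, otherwise the disjoint union of two systems
  \<open>E1\<close> and \<open>E2\<close>; all are rigid, \<open>E0\<close> is a threefold cover of \<open>E1\<close>, and there is no other map
  between them. As coverings preserve degrees, regularity is no obstacle to collapsing \<open>E0\<close> to
  \<open>E1\<close>, while \<open>E1\<close> can only go to \<open>E1\<close>: this forces \<open>h (x m) = h x m\<close>, so \<open>h\<close> is a left translation.
\<close>

section \<open>A rigid subdivided wheel\<close>

text \<open>
  \<open>e + 7\<close> is the intended odd girth. The hub is \<open>0\<close>; the rim vertices of degree three are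
  \<open>1\<close>, \<open>e + 5\<close> and \<open>2 * e + 8\<close>, with spokes \<open>0, 1\<close> and \<open>0, e + 6, e + 5\<close> and
  \<open>0, 2 * e + 10, 2 * e + 9, 2 * e + 8\<close>.
\<close>

definition wheel_arc :: "nat \<Rightarrow> nat \<Rightarrow> nat \<Rightarrow> bool" where
  "wheel_arc e u v \<longleftrightarrow>
     v = Suc u \<and> v < e + 7 \<or> u = e + 6 \<and> v = 0 \<or>
     u = e + 5 \<and> v = e + 7 \<or> e + 7 \<le> u \<and> v = Suc u \<and> v \<le> 2 * e + 10 \<or> u = 2 * e + 10 \<and> v = 0 \<or>
     u = 2 * e + 8 \<and> v = 2 * e + 11 \<or> 2 * e + 11 \<le> u \<and> v = Suc u \<and> v \<le> 3 * e + 12 \<or> u = 3 * e + 12 \<and> v = 1"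

definition wheel :: "nat \<Rightarrow> (nat \<times> nat) set" where
  "wheel e = {(u, v). wheel_arc e u v \<or> wheel_arc e v u}"

text \<open>The faces as closed walks from the hub, face \<open>j\<close> leaving along one spoke
  and returning along the next. The value \<open>0\<close> from \<open>e + 7\<close> on lets index
  \<open>e + 7\<close> close the cycle.\<close>

definition face :: "nat \<Rightarrow> nat \<Rightarrow> nat \<Rightarrow> nat" where
  "face e j i =
     (if i = 0 \<or> e + 7 \<le> i then 0
      else if j = 0 then i
      else if j = 1 then (if i \<le> 2 then e + 7 - i else e + 4 + i)
      else (if i \<le> 3 then 2 * e + 11 - i else if i = e + 6 then 1 else 2 * e + 7 + i))"

text \<open>
  The position \<open>i\<close> of a vertex on a face; a spoke vertex lies on two faces, which traverse it
  in opposite directions, at positions \<open>i\<close> and \<open>e + 7 - i\<close>.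
\<close>

definition face_pos :: "nat \<Rightarrow> nat \<Rightarrow> nat" where
  "face_pos e v = (if v < e + 7 then v else if v \<le> 2 * e + 10 then v - (e + 4) else v - (2 * e + 7))"

definition is_walk :: "('v \<times> 'v) set \<Rightarrow> nat \<Rightarrow> (nat \<Rightarrow> 'v) \<Rightarrow> bool" where
  "is_walk E n w \<longleftrightarrow> (\<forall>i<n. (w i, w (Suc i)) \<in> E)"

section \<open>Faces of the wheel\<close>

lemma wheel_sym: "(u, v) \<in> wheel e \<Longrightarrow> (v, u) \<in> wheel e"
  by (auto simp: wheel_def)

lemma wheel_bound: "(u, v) \<in> wheel e \<Longrightarrow> u < 3 * e + 13 \<and> v < 3 * e + 13"
  by (auto simp: wheel_def wheel_arc_def)

lemma wheel_irrefl: "(u, u) \<notin> wheel e"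
  by (auto simp: wheel_def wheel_arc_def)

lemma face_walk:
  assumes "j < 3" "i < e + 7"
  shows "(face e j i, face e j (Suc i)) \<in> wheel e"
proof -
  consider "j = 0" | "j = 1" | "j = 2" using assms by linarith
  then show ?thesis
  proof cases
    case 1
    consider "i = e + 6" | "i < e + 6" using assms by linarith
    then show ?thesis using 1 by cases (auto simp: face_def wheel_def wheel_arc_def)
  next
    case 2
    consider "i = 0" | "i = 1" | "i = 2" | "3 \<le> i" "i < e + 6" | "i = e + 6" using assms by linarith
    then show ?thesis using 2 by cases (auto simp: face_def wheel_def wheel_arc_def)
  next
    case 3
    consider "i = 0" | "i = 1" | "i = 2" | "i = 3" | "4 \<le> i" "i < e + 5" | "i = e + 5" | "i = e + 6"
      using assms by linarith
    then show ?thesis using 3 by cases (auto simp: face_def wheel_def wheel_arc_def)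
  qed
qed

lemma face_surj: "v < 3 * e + 13 \<Longrightarrow> \<exists>j<3. \<exists>i<e + 7. v = face e j i"
proof -
  assume v: "v < 3 * e + 13"
  consider "v < e + 7" | "e + 7 \<le> v" "v \<le> 2 * e + 10" | "2 * e + 11 \<le> v" by linarith
  then show ?thesis
  proof cases
    case 1
    then show ?thesis by (intro exI[of _ 0]) (auto simp: face_def)
  next
    case 2
    then show ?thesis by (intro exI[of _ 1] conjI exI[of _ "v - (e + 4)"]) (auto simp: face_def)
  next
    case 3
    then show ?thesis using v
      by (intro exI[of _ 2] conjI exI[of _ "v - (2 * e + 7)"]) (auto simp: face_def)
  qed
qed

lemma wheel_edge_in_face:
  assumes "(u, v) \<in> wheel e"
  shows "\<exists>j<3. \<exists>i<e + 7. (u = face e j i \<and> v = face e j (Suc i)) \<or> (v = face e j i \<and> u = face e j (Suc i))"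
proof -
  have *: "\<exists>j<3. \<exists>i<e + 7. (u = face e j i \<and> v = face e j (Suc i)) \<or> (v = face e j i \<and> u = face e j (Suc i))"
    if "wheel_arc e u v" for u v
  proof -
    from that consider "v = Suc u" "v < e + 7" | "u = e + 6" "v = 0" |
      "u = e + 5" "v = e + 7" | "e + 7 \<le> u" "v = Suc u" "v \<le> 2 * e + 10" | "u = 2 * e + 10" "v = 0" |
      "u = 2 * e + 8" "v = 2 * e + 11" | "2 * e + 11 \<le> u" "v = Suc u" "v \<le> 3 * e + 12" | "u = 3 * e + 12" "v = 1"
      by (auto simp: wheel_arc_def)
    then show ?thesis
    proof cases
      case 1 then show ?thesis by (intro exI[of _ 0] conjI exI[of _ u]) (auto simp: face_def)
    next
      case 2 then show ?thesis by (intro exI[of _ 0] conjI exI[of _ u]) (auto simp: face_def)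
    next
      case 3 then show ?thesis by (intro exI[of _ 1] conjI exI[of _ 2]) (auto simp: face_def)
    next
      case 4 then show ?thesis by (intro exI[of _ 1] conjI exI[of _ "u - (e + 4)"]) (auto simp: face_def)
    next
      case 5 then show ?thesis by (intro exI[of _ 1] conjI exI[of _ "e + 6"]) (auto simp: face_def)
    next
      case 6 then show ?thesis by (intro exI[of _ 2] conjI exI[of _ 3]) (auto simp: face_def)
    next
      case 7 then show ?thesis
        by (intro exI[of _ 2] conjI exI[of _ "u - (2 * e + 7)"]) (auto simp: face_def)
    next
      case 8 then show ?thesis by (intro exI[of _ 2] conjI exI[of _ "e + 5"]) (auto simp: face_def)
    qed
  qed
  from assms show ?thesis using *[of u v] *[of v u] by (auto simp: wheel_def)
qed

section \<open>Closed walks of odd length through the hub\<close>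

lemma face_pos_face: "i \<le> e + 7 \<Longrightarrow> face_pos e (face e j i) = i \<or> face_pos e (face e j i) + i = e + 7"
  by (simp add: face_pos_def face_def; linarith)

text \<open>Along a face positions change by one. The sums \<open>e + 6\<close> and
  \<open>e + 8\<close> arise when one of the two vertices is measured in the opposite direction, its
  position \<open>p\<close> being replaced by \<open>e + 7 - p\<close>.\<close>

lemma face_pos_step:
  assumes "(u, v) \<in> wheel e"
  shows "face_pos e v = Suc (face_pos e u) \<or> face_pos e u = Suc (face_pos e v) \<or>
    face_pos e u + face_pos e v = e + 6 \<or> face_pos e u + face_pos e v = e + 8"
proof -
  obtain j i where "i < e + 7" "u = face e j i \<and> v = face e j (Suc i) \<or> v = face e j i \<and> u = face e j (Suc i)"
    using wheel_edge_in_face[OF assms] by blast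
  then show ?thesis using face_pos_face[of i e j] face_pos_face[of "Suc i" e j] by auto
qed

text \<open>The bounds are the lengths of the two ways around a face, which have opposite parity.\<close>

lemma hub_walk_bound:
  assumes "even e" "is_walk (wheel e) n w" "w 0 = 0" "i \<le> n"
  shows "(even i = even (face_pos e (w i)) \<and> face_pos e (w i) \<le> i) \<or>
         (even i \<noteq> even (face_pos e (w i)) \<and> e + 7 \<le> i + face_pos e (w i))"
  using assms(4)
proof (induction i)
  case 0
  then show ?case by (simp add: assms face_pos_def)
next
  case (Suc i)
  have "(w i, w (Suc i)) \<in> wheel e" using Suc assms(2) by (auto simp: is_walk_def)
  note st = face_pos_step[OF this]
  have IH: "(even i = even p \<and> p \<le> i) \<or> (even i \<noteq> even p \<and> e + 7 \<le> i + p)"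
    if "p = face_pos e (w i)" for p
    using Suc that by auto
  have "(even (Suc i) = even q \<and> q \<le> Suc i) \<or> (even (Suc i) \<noteq> even q \<and> e + 7 \<le> Suc i + q)"
    if p: "p = face_pos e (w i)" and q: "q = Suc p \<or> p = Suc q \<or> p + q = e + 6 \<or> p + q = e + 8" for p q
    using q
  proof (elim disjE)
    assume "q = Suc p" then show ?thesis using IH[OF p] by auto
  next
    assume "p = Suc q" then show ?thesis using IH[OF p] by auto
  next
    assume *: "p + q = e + 6"
    then have "even (p + q)" using assms(1) by simp
    then have "even p = even q" by simp
    then show ?thesis using IH[OF p] * by auto
  next
    assume *: "p + q = e + 8"
    then have "even (p + q)" using assms(1) by simp
    then have "even p = even q" by simp
    then show ?thesis using IH[OF p] * by auto
  qed
  from this[OF refl st] show ?case .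
qed

lemma hub_walk_odd_length:
  assumes "even e" "is_walk (wheel e) n w" "w 0 = 0" "w n = 0" "odd n"
  shows "e + 7 \<le> n"
  using hub_walk_bound[OF assms(1-3), of n] assms(4,5) by (auto simp: face_pos_def)

lemma is_walk_rev:
  assumes "is_walk E n w" "sym E" shows "is_walk E n (\<lambda>i. w (n - i))"
  unfolding is_walk_def
proof (intro allI impI)
  fix i assume "i < n"
  then have "(w (n - Suc i), w (Suc (n - Suc i))) \<in> E" using assms(1) unfolding is_walk_def by auto
  moreover have "Suc (n - Suc i) = n - i" using \<open>i < n\<close> by auto
  ultimately show "(w (n - i), w (n - Suc i)) \<in> E" using assms(2) by (auto dest: symD)
qed

lemma sym_wheel: "sym (wheel e)"
  by (auto simp: sym_def wheel_sym)

text \<open>Both the walk and its reversal satisfy \<open>hub_walk_bound\<close>. As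
  \<open>e + 7\<close> is odd, the lower and upper bounds of the two walks match and become
  equalities.\<close>

lemma hub_cycle_pos:
  assumes "even e" "is_walk (wheel e) (e + 7) w" "w 0 = 0" "w (e + 7) = 0" "i \<le> e + 7"
  shows "face_pos e (w i) = i \<or> face_pos e (w i) + i = e + 7"
proof -
  have b: "is_walk (wheel e) (e + 7) (\<lambda>i. w (e + 7 - i))"
    using is_walk_rev[OF assms(2) sym_wheel] .
  have "e + 7 - (e + 7 - i) = i" using assms(5) by simp
  then show ?thesis
    using hub_walk_bound[OF assms(1,2,3) assms(5)] hub_walk_bound[OF assms(1) b, of "e + 7 - i"] assms
    by auto
qed

text \<open>The six exceptional alternatives are the third neighbours of the three rim branch
  vertices, each of which lies on two faces.\<close>

lemma face_neighbours:
  assumes "j < 3" "0 < k" "k < e + 7" "(face e j k, v) \<in> wheel e"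
  shows "v = face e j (k - 1) \<or> v = face e j (Suc k) \<or>
    j = 0 \<and> k = 1 \<and> v = 3 * e + 12 \<or> j = 0 \<and> k = e + 5 \<and> v = e + 7 \<or>
    j = 1 \<and> k = 2 \<and> v = e + 4 \<or> j = 1 \<and> k = e + 4 \<and> v = 2 * e + 11 \<or>
    j = 2 \<and> k = 3 \<and> v = 2 * e + 7 \<or> j = 2 \<and> k = e + 6 \<and> v = 2"
proof -
  have ar: "wheel_arc e (face e j k) v \<or> wheel_arc e v (face e j k)" using assms(4)
    by (auto simp: wheel_def)
  obtain l where l: "k = Suc l" using assms(2) by (cases k) auto
  consider "j = 0" | "j = 1" | "j = 2" using assms by linarith
  then show ?thesis
  proof cases
    case 1
    then have "face e j k = k" "face e j (Suc k) = (if k = e + 6 then 0 else Suc k)" "face e j (k - 1) = l"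
      using assms(2,3) l by (auto simp: face_def)
    then show ?thesis using 1 assms(3) l ar unfolding wheel_arc_def by auto
  next
    case 2
    consider "k = 1" | "k = 2" | "k = 3" | "4 \<le> k" "k \<le> e + 5" | "k = e + 6" using assms(2,3)
      by linarith
    then show ?thesis
    proof cases
      case 4
      then have "face e j k = e + 4 + k" "face e j (Suc k) = e + 5 + k" "face e j (k - 1) = e + 3 + k"
        using 2 assms(3) by (auto simp: face_def)
      then show ?thesis using 2 4 assms(3) ar unfolding wheel_arc_def by auto
    next
      case 1
      then have "face e j k = e + 6" "face e j (Suc k) = e + 5" "face e j (k - 1) = 0" using 2
        by (simp_all add: face_def)
      then show ?thesis using 2 1 ar unfolding wheel_arc_def by auto
    next
      case 2
      then have "face e j k = e + 5" "face e j (Suc k) = e + 7" "face e j (k - 1) = e + 6"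
        using \<open>j = 1\<close> by (simp_all add: face_def)
      then show ?thesis using 2 \<open>j = 1\<close> ar unfolding wheel_arc_def by auto
    next
      case 3
      then have "face e j k = e + 7" "face e j (Suc k) = e + 8" "face e j (k - 1) = e + 5" using 2
        by (simp_all add: face_def)
      then show ?thesis using 2 3 ar unfolding wheel_arc_def by auto
    next
      case 5
      then have "face e j k = 2 * e + 10" "face e j (Suc k) = 0" "face e j (k - 1) = 2 * e + 9" using 2
        by (simp_all add: face_def)
      then show ?thesis using 2 5 ar unfolding wheel_arc_def by auto
    qed
  next
    case 3
    consider "k = 1" | "k = 2" | "k = 3" | "k = 4" | "5 \<le> k" "k \<le> e + 4" | "k = e + 5" | "k = e + 6"
      using assms(2,3) by linarith
    then show ?thesis
    proof cases
      case 5
      then have "face e j k = 2 * e + 7 + k" "face e j (Suc k) = 2 * e + 8 + k" "face e j (k - 1) = 2 * e + 6 + k"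
        using 3 assms(3) by (auto simp: face_def)
      then show ?thesis using 3 5 assms(3) ar unfolding wheel_arc_def by auto
    next
      case 1
      then have "face e j k = 2 * e + 10" "face e j (Suc k) = 2 * e + 9" "face e j (k - 1) = 0" using 3
        by (simp_all add: face_def)
      then show ?thesis using 3 1 ar unfolding wheel_arc_def by auto
    next
      case 2
      then have "face e j k = 2 * e + 9" "face e j (Suc k) = 2 * e + 8" "face e j (k - 1) = 2 * e + 10"
        using 3 by (simp_all add: face_def)
      then show ?thesis using 2 3 ar unfolding wheel_arc_def by auto
    next
      case 3
      then have "face e j k = 2 * e + 8" "face e j (Suc k) = 2 * e + 11" "face e j (k - 1) = 2 * e + 9"
        using \<open>j = 2\<close> by (simp_all add: face_def)
      then show ?thesis using \<open>j = 2\<close> 3 ar unfolding wheel_arc_def by auto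
    next
      case 4
      then have "face e j k = 2 * e + 11" "face e j (Suc k) = 2 * e + 12" "face e j (k - 1) = 2 * e + 8" using 3 by (simp_all add: face_def)
      then show ?thesis using 3 4 ar unfolding wheel_arc_def by auto
    next
      case 6
      then have "face e j k = 3 * e + 12" "face e j (Suc k) = 1" using 3 by (simp_all add: face_def)
      moreover have "face e j (k - 1) = 3 * e + 11" using 3 6 by (auto simp add: face_def)
      ultimately show ?thesis using 3 6 ar unfolding wheel_arc_def by auto
    next
      case 7
      then have "face e j k = 1" "face e j (Suc k) = 0" "face e j (k - 1) = 3 * e + 12" using 3
        by (simp_all add: face_def)
      then show ?thesis using 3 7 ar unfolding wheel_arc_def by auto
    qed
  qed
qed

text \<open>Spokes have length at most 3, so from index 4 on the first branch vertex of the face has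
  been passed. Leaving the face at the second one leads to a wrong position, and turning back would
  need \<open>2 * i = e + 7\<close>, which parity excludes.\<close>

lemma face_step:
  assumes "even e" "j < 3" "4 \<le> i" "i < e + 7" "(face e j i, v) \<in> wheel e"
    "face_pos e v = Suc i \<or> face_pos e v + Suc i = e + 7"
  shows "v = face e j (Suc i)"
proof -
  have "face_pos e (e + 7) = 3" "face_pos e (2 * e + 11) = 4" "face_pos e 2 = 2"
    by (auto simp: face_pos_def)
  moreover have "2 * i \<noteq> e + 7" using assms(1) by presburger
  moreover have "face_pos e (face e j (i - 1)) = i - 1 \<or> face_pos e (face e j (i - 1)) + i = e + 8"
    using face_pos_face[of "i - 1" e j] assms(3,4) by linarith
  ultimately show ?thesis
    using face_neighbours[OF assms(2) _ assms(4,5)] assms(3,4,6) by auto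
qed

lemma face_rev_step:
  assumes "even e" "j < 3" "4 \<le> i" "i < e + 7" "(face e j (e + 7 - i), v) \<in> wheel e"
    "face_pos e v = Suc i \<or> face_pos e v + Suc i = e + 7"
  shows "v = face e j (e + 7 - Suc i)"
proof -
  define k where "k = e + 7 - i"
  have k: "i + k = e + 7" "0 < k" "k \<le> e + 3" "e + 7 - Suc i = k - 1" using assms(3,4)
    by (auto simp: k_def)
  have "face_pos e (e + 4) = e + 4" "face_pos e (2 * e + 7) = e + 3" "face_pos e (3 * e + 12) = e + 5"
    by (auto simp: face_pos_def)
  moreover have "2 * i \<noteq> e + 7" using assms(1) by presburger
  moreover have "face_pos e (face e j (Suc k)) = Suc k \<or> face_pos e (face e j (Suc k)) + Suc k = e + 7"
    using face_pos_face[of "Suc k" e j] k by auto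
  moreover have "(face e j k, v) \<in> wheel e" using assms(5) by (simp add: k_def)
  ultimately show ?thesis
    using face_neighbours[OF assms(2), of k e v] assms(3,6) k by auto
qed

text \<open>The first four steps run along a spoke and choose one of the two faces at its end,
  positions ruling out a return; afterwards the positions force the walk to follow that
  face.\<close>

lemma hub_cycle_face:
  assumes "even e" "is_walk (wheel e) (e + 7) w" "w 0 = 0" "w (e + 7) = 0"
  shows "\<exists>j<3. (\<forall>i\<le>e + 7. w i = face e j i) \<or> (\<forall>i\<le>e + 7. w i = face e j (e + 7 - i))"
proof -
  have st: "(w i, w (Suc i)) \<in> wheel e" if "i < e + 7" for i
    using assms(2) that by (auto simp: is_walk_def)
  note pos = hub_cycle_pos[OF assms]
  have p2: "face_pos e (w 2) = 2 \<or> face_pos e (w 2) = e + 5" using pos[of 2] by auto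
  have p3: "face_pos e (w 3) = 3 \<or> face_pos e (w 3) = e + 4" using pos[of 3] by auto
  have p4: "face_pos e (w 4) = 4 \<or> face_pos e (w 4) = e + 3" using pos[of 4] by auto
  have e01: "(0, w 1) \<in> wheel e" using st[of 0] assms(3) by simp
  have e12: "(w 1, w 2) \<in> wheel e" using st[of 1] by (simp add: eval_nat_numeral)
  have e23: "(w 2, w 3) \<in> wheel e" using st[of 2] by (simp add: eval_nat_numeral)
  have e34: "(w 3, w 4) \<in> wheel e" using st[of 3] by (simp add: eval_nat_numeral)
  have w1: "w 1 = 1 \<or> w 1 = e + 6 \<or> w 1 = 2 * e + 10"
    using e01 by (auto simp: wheel_def wheel_arc_def)
  have init: "\<exists>j<3. (\<forall>i\<in>{1,2,3,4}. w i = face e j i) \<or> (\<forall>i\<in>{1,2,3,4}. w i = face e j (e + 7 - i))"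
    using w1
  proof (elim disjE)
    assume a: "w 1 = 1"
    have "w 2 = 0 \<or> w 2 = 2 \<or> w 2 = 3 * e + 12" using e12 unfolding a
      by (auto simp: wheel_def wheel_arc_def)
    moreover have "w 2 \<noteq> 0" using p2 by (intro notI) (auto simp: face_pos_def)
    ultimately consider "w 2 = 2" | "w 2 = 3 * e + 12" by auto
    then show ?thesis
    proof cases
      case 1
      have "w 3 = 1 \<or> w 3 = 3" using e23 unfolding 1 by (auto simp: wheel_def wheel_arc_def)
      moreover have "w 3 \<noteq> 1" using p3 by (intro notI) (auto simp: face_pos_def)
      ultimately have 2: "w 3 = 3" by auto
      have "w 4 = 2 \<or> w 4 = 4" using e34 unfolding 2 by (auto simp: wheel_def wheel_arc_def)
      moreover have "w 4 \<noteq> 2" using p4 by (intro notI) (auto simp: face_pos_def)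
      ultimately have 3: "w 4 = 4" by auto
      show ?thesis using a 1 2 3 by (intro exI[of _ 0]) (auto simp: face_def)
    next
      case 1: 2
      have "w 3 = 1 \<or> w 3 = 3 * e + 11" using e23 unfolding 1 by (auto simp: wheel_def wheel_arc_def)
      moreover have "w 3 \<noteq> 1" using p3 by (intro notI) (auto simp: face_pos_def)
      ultimately have 2: "w 3 = 3 * e + 11" by auto
      \<comment> \<open>For \<open>e = 0\<close> the path from \<open>2 * e + 11\<close> to
        \<open>3 * e + 12\<close> has only two vertices, so \<open>3 * e + 11\<close> is already
        adjacent to the branch vertex \<open>2 * e + 8\<close>.\<close>
      have "w 4 = 3 * e + 12 \<or> w 4 = (if e = 0 then 2 * e + 8 else 3 * e + 10)"
        using e34 unfolding 2 by (auto simp: wheel_def wheel_arc_def)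
      moreover have "w 4 \<noteq> 3 * e + 12" using p4 by (intro notI) (auto simp: face_pos_def)
      ultimately have 3: "w 4 = (if e = 0 then 2 * e + 8 else 3 * e + 10)" by auto
      show ?thesis using a 1 2 3 by (intro exI[of _ 2]) (auto simp: face_def)
    qed
  next
    assume a: "w 1 = e + 6"
    have "w 2 = 0 \<or> w 2 = e + 5" using e12 unfolding a by (auto simp: wheel_def wheel_arc_def)
    moreover have "w 2 \<noteq> 0" using p2 by (intro notI) (auto simp: face_pos_def)
    ultimately have 0: "w 2 = e + 5" by auto
    have "w 3 = e + 6 \<or> w 3 = e + 4 \<or> w 3 = e + 7" using e23 unfolding 0
      by (auto simp: wheel_def wheel_arc_def)
    moreover have "w 3 \<noteq> e + 6" using p3 by (intro notI) (auto simp: face_pos_def)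
    ultimately consider "w 3 = e + 4" | "w 3 = e + 7" by auto
    then show ?thesis
    proof cases
      case 1
      have "w 4 = e + 5 \<or> w 4 = e + 3" using e34 unfolding 1 by (auto simp: wheel_def wheel_arc_def)
      moreover have "w 4 \<noteq> e + 5" using p4 by (intro notI) (auto simp: face_pos_def)
      ultimately have 3: "w 4 = e + 3" by auto
      show ?thesis using a 0 1 3 by (intro exI[of _ 0]) (auto simp: face_def)
    next
      case 2
      have "w 4 = e + 5 \<or> w 4 = e + 8" using e34 unfolding 2 by (auto simp: wheel_def wheel_arc_def)
      moreover have "w 4 \<noteq> e + 5" using p4 by (intro notI) (auto simp: face_pos_def)
      ultimately have 3: "w 4 = e + 8" by auto
      show ?thesis using a 0 2 3 by (intro exI[of _ 1]) (auto simp: face_def)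
    qed
  next
    assume a: "w 1 = 2 * e + 10"
    have "w 2 = 0 \<or> w 2 = 2 * e + 9" using e12 unfolding a by (auto simp: wheel_def wheel_arc_def)
    moreover have "w 2 \<noteq> 0" using p2 by (intro notI) (auto simp: face_pos_def)
    ultimately have 0: "w 2 = 2 * e + 9" by auto
    have "w 3 = 2 * e + 10 \<or> w 3 = 2 * e + 8" using e23 unfolding 0
      by (auto simp: wheel_def wheel_arc_def)
    moreover have "w 3 \<noteq> 2 * e + 10" using p3 by (intro notI) (auto simp: face_pos_def)
    ultimately have 1: "w 3 = 2 * e + 8" by auto
    have "w 4 = 2 * e + 9 \<or> w 4 = 2 * e + 7 \<or> w 4 = 2 * e + 11" using e34 unfolding 1
      by (auto simp: wheel_def wheel_arc_def)
    moreover have "w 4 \<noteq> 2 * e + 9" using p4 by (intro notI) (auto simp: face_pos_def)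
    ultimately consider "w 4 = 2 * e + 7" | "w 4 = 2 * e + 11" by auto
    then show ?thesis
    proof cases
      case 2: 1
      show ?thesis using a 0 1 2 by (intro exI[of _ 1]) (auto simp: face_def)
    next
      case 2
      show ?thesis using a 0 1 2 by (intro exI[of _ 2]) (auto simp: face_def)
    qed
  qed
  have small: "w i = f i" if "i \<le> 4" "\<forall>i\<in>{1,2,3,4}. w i = f i" "f 0 = 0" for i f
  proof -
    have "i \<in> {0,1,2,3,4}" using that(1) by auto
    then show ?thesis using that assms(3) by auto
  qed
  from init obtain j where j: "j < 3"
    and d: "(\<forall>i\<in>{1,2,3,4}. w i = face e j i) \<or> (\<forall>i\<in>{1,2,3,4}. w i = face e j (e + 7 - i))" by blast
  from d show ?thesis
  proof
    assume f: "\<forall>i\<in>{1,2,3,4}. w i = face e j i"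
    have "i \<le> e + 7 \<longrightarrow> w i = face e j i" if "4 \<le> i" for i
      using that
    proof (induction i rule: dec_induct)
      case base then show ?case using f by simp
    next
      case (step i)
      then show ?case using face_step[OF assms(1) j step(1), of "w (Suc i)"] st[of i] pos[of "Suc i"]
        by auto
    qed
    then have "\<forall>i\<le>e + 7. w i = face e j i" using small[OF _ f]
      by (metis face_def nat_le_linear)
    then show ?thesis using j by blast
  next
    assume f: "\<forall>i\<in>{1,2,3,4}. w i = face e j (e + 7 - i)"
    have "i \<le> e + 7 \<longrightarrow> w i = face e j (e + 7 - i)" if "4 \<le> i" for i
      using that
    proof (induction i rule: dec_induct)
      case base then show ?case using f by simp
    next
      case (step i)
      then show ?case using face_rev_step[OF assms(1) j step(1), of "w (Suc i)"] st[of i] pos[of "Suc i"]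
        by auto
    qed
    moreover have "face e j (e + 7 - 0) = 0" by (simp add: face_def)
    ultimately have "\<forall>i\<le>e + 7. w i = face e j (e + 7 - i)" using small[OF _ f]
      by (metis nat_le_linear)
    then show ?thesis using j by blast
  qed
qed

section \<open>Closed walks that avoid the hub, and the odd girth of the wheel\<close>

lemma odd_sum_signs:
  fixes s :: "nat \<Rightarrow> int"
  assumes "\<And>i. i < n \<Longrightarrow> s i = 1 \<or> s i = -1"
  shows "odd (\<Sum>i<n. s i) = odd n \<and> \<bar>\<Sum>i<n. s i\<bar> \<le> int n"
  using assms
proof (induction n)
  case (Suc n)
  then have "odd (\<Sum>i<n. s i) = odd n \<and> \<bar>\<Sum>i<n. s i\<bar> \<le> int n" "s n = 1 \<or> s n = -1" by auto
  then show ?case by auto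
qed simp

text \<open>Since the walk closes, the signs of its steps sum to a multiple of \<open>m\<close>. An
  odd number of signs has a nonzero sum, of absolute value at most \<open>n\<close>.\<close>

lemma closed_walk_mod:
  fixes h :: "nat \<Rightarrow> int" and m :: int
  assumes "odd n" "h n = h 0" "\<And>i. i < n \<Longrightarrow> \<exists>s. (s = 1 \<or> s = -1) \<and> m dvd h (Suc i) - h i - s"
  shows "m \<le> int n"
proof -
  obtain s where s: "\<And>i. i < n \<Longrightarrow> (s i = 1 \<or> s i = -1) \<and> m dvd h (Suc i) - h i - s i"
    using assms(3) by metis
  have "m dvd (\<Sum>i<n. h (Suc i) - h i - s i)" using s by (intro dvd_sum) auto
  also have "(\<Sum>i<n. h (Suc i) - h i - s i) = h n - h 0 - (\<Sum>i<n. s i)"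
    by (induction n) simp_all
  finally have "m dvd (\<Sum>i<n. s i)" using assms(2) by simp
  moreover have "odd (\<Sum>i<n. s i)" "\<bar>\<Sum>i<n. s i\<bar> \<le> int n"
    using odd_sum_signs[of n s] s assms(1) by auto
  ultimately have "\<bar>m\<bar> \<le> \<bar>\<Sum>i<n. s i\<bar>" by (intro dvd_imp_le_int) auto
  then show ?thesis using \<open>\<bar>\<Sum>i<n. s i\<bar> \<le> int n\<close> by linarith
qed

text \<open>
  Without the hub, the wheel maps to its rim, a cycle of length \<open>3 * e + 9 > e + 7\<close>: the interiors
  of the spokes are folded onto it.
\<close>

definition rim_pos :: "nat \<Rightarrow> nat \<Rightarrow> int" where
  "rim_pos e v = int v - (if v < e + 7 then 1 else if v \<le> 2 * e + 10 then 2 else 4)"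

lemma rim_pos_step:
  assumes "(u, v) \<in> wheel e" "u \<noteq> 0" "v \<noteq> 0"
  shows "\<exists>s. (s = 1 \<or> s = -1) \<and> int (3 * e + 9) dvd rim_pos e v - rim_pos e u - s"
proof -
  \<comment> \<open>The value \<open>- int (3 * e + 8)\<close> is the jump at the closing edge from
    \<open>3 * e + 12\<close> to \<open>1\<close>; it is congruent to 1 modulo the rim
    length.\<close>
  have *: "\<exists>t. (t = 1 \<or> t = - int (3 * e + 8)) \<and> rim_pos e v - rim_pos e u = t"
    if "wheel_arc e u v" "u \<noteq> 0" "v \<noteq> 0" for u v
  proof -
    from that consider "v = Suc u" "u < e + 6" "0 < u" | "u = e + 5" "v = e + 7" | "e + 7 \<le> u" "v = Suc u" "v \<le> 2 * e + 10" |
      "u = 2 * e + 8" "v = 2 * e + 11" | "2 * e + 11 \<le> u" "v = Suc u" | "u = 3 * e + 12" "v = 1"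
      by (auto simp: wheel_arc_def)
    then show ?thesis by cases (simp_all add: rim_pos_def)
  qed
  have d: "int (3 * e + 9) dvd - int (3 * e + 8) - 1" "int (3 * e + 9) dvd int (3 * e + 8) + 1"
    by (auto simp: dvd_def intro: exI[of _ "-1"] exI[of _ 1])
  from assms(1) consider "wheel_arc e u v" | "wheel_arc e v u" by (auto simp: wheel_def)
  then show ?thesis
  proof cases
    case 1
    obtain t where "t = 1 \<or> t = - int (3 * e + 8)" "rim_pos e v - rim_pos e u = t"
      using *[OF 1 assms(2,3)] by blast
    then have "rim_pos e v - rim_pos e u - 1 = 0 \<or> rim_pos e v - rim_pos e u - 1 = - int (3 * e + 8) - 1" by auto
    then show ?thesis using d by (metis dvd_0_right)
  next
    case 2
    then obtain t where "t = 1 \<or> t = - int (3 * e + 8)" "rim_pos e u - rim_pos e v = t"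
      using * assms(2,3) by blast
    then have "rim_pos e v - rim_pos e u - (-1) = 0 \<or> rim_pos e v - rim_pos e u - (-1) = int (3 * e + 8) + 1" by auto
    then show ?thesis using d by (metis dvd_0_right)
  qed
qed

definition rotate_walk :: "nat \<Rightarrow> nat \<Rightarrow> (nat \<Rightarrow> 'v) \<Rightarrow> nat \<Rightarrow> 'v" where
  "rotate_walk n t w k = w (if k + t \<le> n then k + t else k + t - n)"

lemma is_walk_rotate:
  assumes "is_walk E n w" "w n = w 0" "t \<le> n"
  shows "is_walk E n (rotate_walk n t w)"
  unfolding is_walk_def
proof (intro allI impI)
  fix k assume k: "k < n"
  consider "k + t < n" | "k + t = n" | "k + t > n" by linarith
  then show "(rotate_walk n t w k, rotate_walk n t w (Suc k)) \<in> E"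
  proof cases
    case 2
    then have "rotate_walk n t w k = w 0" "rotate_walk n t w (Suc k) = w (Suc 0)"
      using assms(2) by (auto simp: rotate_walk_def)
    then show ?thesis using assms(1) k by (auto simp: is_walk_def)
  next
    case 3
    then have "rotate_walk n t w k = w (k + t - n)" "rotate_walk n t w (Suc k) = w (Suc (k + t - n))"
      by (auto simp: rotate_walk_def Suc_diff_le)
    moreover have "k + t - n < n" using 3 assms(3) k by linarith
    ultimately show ?thesis using assms(1) by (auto simp: is_walk_def)
  qed (use assms(1) in \<open>auto simp: is_walk_def rotate_walk_def\<close>)
qed

lemma rotate_walk_ends:
  assumes "w n = w 0" "t \<le> n"
  shows "rotate_walk n t w 0 = w t" "rotate_walk n t w n = w t"
  using assms by (auto simp: rotate_walk_def)

text \<open>A walk through the hub is restarted there, where the position bound applies. A walk that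
  avoids the hub maps to the rim and has length at least \<open>3 * e + 9\<close>, more than
  \<open>e + 7\<close>.\<close>

lemma wheel_odd_closed_walk:
  assumes "even e" "is_walk (wheel e) n w" "w n = w 0" "odd n"
  shows "e + 7 \<le> n \<and> (n = e + 7 \<longrightarrow> (\<exists>t<n. w t = 0))"
proof (cases "\<exists>t<n. w t = 0")
  case True
  then obtain t where t: "t < n" "w t = 0" by blast
  then show ?thesis
    using hub_walk_odd_length[OF assms(1) is_walk_rotate[OF assms(2,3), of t]] rotate_walk_ends[of w n t] assms(3,4)
    by auto
next
  case False
  have nz: "w i \<noteq> 0" if "i \<le> n" for i
    using False assms(3,4) that by (cases "i = n") (auto dest: odd_pos)
  have "int (3 * e + 9) \<le> int n"
    using assms(2,3) nz
    by (intro closed_walk_mod[OF assms(4), of "\<lambda>i. rim_pos e (w i)"] rim_pos_step) (auto simp: is_walk_def)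
  then show ?thesis by auto
qed

section \<open>Closed walks of length \<open>e + 7\<close> and rigidity of the wheel\<close>

text \<open>Otherwise the two edges at the start could be cut off, leaving an odd closed walk of
  length \<open>e + 5\<close>.\<close>

lemma girth_cycle_no_backtrack:
  assumes "even e" "is_walk (wheel e) (e + 7) w" "w (e + 7) = w 0"
  shows "w 1 \<noteq> w (e + 6)"
proof
  assume "w 1 = w (e + 6)"
  then have "is_walk (wheel e) (e + 5) (\<lambda>i. w (Suc i))" "w (Suc (e + 5)) = w (Suc 0)"
    using assms(2) by (auto simp: is_walk_def eval_nat_numeral)
  from wheel_odd_closed_walk[OF assms(1) this] show False using assms(1) by auto
qed

lemma girth_cycle_face:
  assumes "even e" "is_walk (wheel e) (e + 7) w" "w (e + 7) = w 0" "w 0 \<noteq> 0"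
  shows "\<exists>j<3. \<exists>k. 0 < k \<and> k < e + 7 \<and> w 0 = face e j k \<and> {w 1, w (e + 6)} = {face e j (k - 1), face e j (Suc k)}"
proof -
  obtain t where t: "t < e + 7" "w t = 0" using wheel_odd_closed_walk[OF assms(1-3)] assms(1) by auto
  have "0 < t" using t assms(4) by (cases t) auto
  define w' where "w' = rotate_walk (e + 7) t w"
  have w': "is_walk (wheel e) (e + 7) w'" "w' 0 = 0" "w' (e + 7) = 0"
    using is_walk_rotate[OF assms(2,3), of t] rotate_walk_ends[OF assms(3), of t] t
      by (auto simp: w'_def)
  define k where "k = e + 7 - t"
  have k: "0 < k" "k < e + 7" "t = e + 7 - k" using t \<open>0 < t\<close> by (auto simp: k_def)
  have v: "w' k = w 0" "w' (k - 1) = w (e + 6)" "w' (Suc k) = w 1"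
    using k assms(3) by (auto simp: w'_def rotate_walk_def add.commute)
  obtain j where j: "j < 3" "(\<forall>i\<le>e + 7. w' i = face e j i) \<or> (\<forall>i\<le>e + 7. w' i = face e j (e + 7 - i))"
    using hub_cycle_face[OF assms(1) w'] by blast
  from j(2) show ?thesis
  proof
    assume "\<forall>i\<le>e + 7. w' i = face e j i"
    then have "w 0 = face e j k \<and> {w 1, w (e + 6)} = {face e j (k - 1), face e j (Suc k)}"
      using v k by (auto simp: Suc_le_eq simp flip: v)
    then show ?thesis using j(1) k by blast
  next
    assume a: "\<forall>i\<le>e + 7. w' i = face e j (e + 7 - i)"
    have "w 0 = face e j t" using a v(1) k by (metis diff_le_self k_def)
    moreover have "w (e + 6) = face e j (Suc t)"
    proof -
      have "e + 7 - (k - 1) = Suc t" "k - 1 \<le> e + 7" using k by auto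
      then show ?thesis using a v(2) by metis
    qed
    moreover have "w 1 = face e j (t - 1)"
    proof -
      have "e + 7 - Suc k = t - 1" "Suc k \<le> e + 7" using k by auto
      then show ?thesis using a v(3) by metis
    qed
    ultimately show ?thesis using j(1) t \<open>0 < t\<close>
      by (intro exI[of _ j] conjI exI[of _ t]) auto
  qed
qed

text \<open>Each face through a rim branch vertex contains the spoke ending there, so a closed walk
  of minimal odd length cannot pass this vertex along the rim only.\<close>

lemma girth_cycle_at_branch:
  assumes "even e" "is_walk (wheel e) (e + 7) w" "w (e + 7) = w 0"
  shows "w 0 = 1 \<Longrightarrow> w 1 = 0 \<or> w (e + 6) = 0"
    "w 0 = e + 5 \<Longrightarrow> w 1 = e + 6 \<or> w (e + 6) = e + 6"
    "w 0 = 2 * e + 8 \<Longrightarrow> w 1 = 2 * e + 9 \<or> w (e + 6) = 2 * e + 9"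
proof -
  have *: "w 1 = q \<or> w (e + 6) = q"
    if "w 0 = x" "x \<noteq> 0"
      and "\<And>j k. j < 3 \<Longrightarrow> face e j k = x \<Longrightarrow> 0 < k \<Longrightarrow> k < e + 7 \<Longrightarrow> face e j (k - 1) = q \<or> face e j (Suc k) = q" for x q
  proof -
    have "w 0 \<noteq> 0" using that by simp
    from girth_cycle_face[OF assms this]
    obtain j k where "j < 3" "0 < k" "k < e + 7" "w 0 = face e j k" and
      eq: "{w 1, w (e + 6)} = {face e j (k - 1), face e j (Suc k)}"
      by blast
    then have "q \<in> {face e j (k - 1), face e j (Suc k)}" using that(1) that(3)[of j k] by auto
    then have "q \<in> {w 1, w (e + 6)}" unfolding eq .
    then show ?thesis by blast
  qed
  show "w 0 = 1 \<Longrightarrow> w 1 = 0 \<or> w (e + 6) = 0"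
    by (rule *) (auto simp: face_def split: if_splits)
  show "w 0 = e + 5 \<Longrightarrow> w 1 = e + 6 \<or> w (e + 6) = e + 6"
    by (rule *) (auto simp: face_def split: if_splits)
  show "w 0 = 2 * e + 8 \<Longrightarrow> w 1 = 2 * e + 9 \<or> w (e + 6) = 2 * e + 9"
    by (rule *) (auto simp: face_def split: if_splits)
qed

lemma wheel_neighbours_deg2:
  assumes "x < 3 * e + 13" "x \<notin> {0, 1, e + 5, 2 * e + 8}"
  shows "\<exists>a b. \<forall>y. (x, y) \<in> wheel e \<longrightarrow> y = a \<or> y = b"
proof -
  obtain j k where jk: "j < 3" "k < e + 7" "x = face e j k" using face_surj[OF assms(1)] by blast
  have "0 < k" using jk assms(2) by (cases k) (auto simp: face_def)
  have nb: "\<not> (j = 0 \<and> k = 1)" "\<not> (j = 0 \<and> k = e + 5)" "\<not> (j = 1 \<and> k = 2)" "\<not> (j = 1 \<and> k = e + 4)"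
    "\<not> (j = 2 \<and> k = 3)" "\<not> (j = 2 \<and> k = e + 6)"
    using jk(3) assms(2) by (auto simp: face_def)
  have "y = face e j (k - 1) \<or> y = face e j (Suc k)" if "(x, y) \<in> wheel e" for y
    using face_neighbours[OF jk(1) \<open>0 < k\<close> jk(2), of y] that jk(3) nb by blast
  then show ?thesis by blast
qed


text \<open>Tabulates both traversals of each face on the three positions next to either end, enough
  to compare faces along a common spoke. The second part identifies the whole walk from its end
  vertices.\<close>

lemma hub_cycle_ends:
  assumes "even e" "is_walk (wheel e) (e + 7) w" "w 0 = 0" "w (e + 7) = 0"
  shows "(w 1, w 2, w 3, w (e + 4), w (e + 5), w (e + 6)) \<in>
    {(1, 2, 3, e + 4, e + 5, e + 6),
     (e + 6, e + 5, e + 4, 3, 2, 1),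
     (e + 6, e + 5, e + 7, 2 * e + 8, 2 * e + 9, 2 * e + 10),
     (2 * e + 10, 2 * e + 9, 2 * e + 8, e + 7, e + 5, e + 6),
     (2 * e + 10, 2 * e + 9, 2 * e + 8, 3 * e + 11, 3 * e + 12, 1),
     (1, 3 * e + 12, 3 * e + 11, 2 * e + 8, 2 * e + 9, 2 * e + 10)}" (is "?t \<in> ?S")
    and "j < 3 \<Longrightarrow> w 1 = face e j 1 \<Longrightarrow> w (e + 6) = face e j (e + 6) \<Longrightarrow> i \<le> e + 7 \<Longrightarrow> w i = face e j i"
proof -
  obtain k where k: "k < 3" and
    d: "(\<forall>i\<le>e + 7. w i = face e k i) \<or> (\<forall>i\<le>e + 7. w i = face e k (e + 7 - i))"
    using hub_cycle_face[OF assms] by blast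
  have e: "(w 1 = face e k 1 \<and> w 2 = face e k 2 \<and> w 3 = face e k 3 \<and>
      w (e + 4) = face e k (e + 4) \<and> w (e + 5) = face e k (e + 5) \<and> w (e + 6) = face e k (e + 6) \<and>
      (\<forall>i\<le>e + 7. w i = face e k i)) \<or>
     (w 1 = face e k (e + 6) \<and> w 2 = face e k (e + 5) \<and> w 3 = face e k (e + 4) \<and>
      w (e + 4) = face e k 3 \<and> w (e + 5) = face e k 2 \<and> w (e + 6) = face e k 1)"
    using d by (auto simp: add.commute)
  have k': "k = 0 \<or> k = 1 \<or> k = 2" using k by linarith
  show "?t \<in> ?S"
    using e k' by (elim disjE) (simp_all add: face_def)
  assume j: "j < 3" "w 1 = face e j 1" "w (e + 6) = face e j (e + 6)" "i \<le> e + 7"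
  have "j = 0 \<or> j = 1 \<or> j = 2" using j by linarith
  then show "w i = face e j i" using e k' j(2-4) by (elim disjE) (simp_all add: face_def)
qed

text \<open>The images of the three faces are closed walks of minimal odd length with common start
  \<open>f 0\<close>, and the images of the hub neighbours are distinct. This forces
  \<open>f 0 = 0\<close>; then the distinct spoke lengths leave no permutation of the spokes but the
  identity.\<close>

theorem wheel_rigid:
  assumes "even e" and hom: "\<And>u v. (u, v) \<in> wheel e \<Longrightarrow> (f u, f v) \<in> wheel e"
    and "v < 3 * e + 13"
  shows "f v = v"
proof -
  define w where "w j i = f (face e j i)" for j i
  have w: "is_walk (wheel e) (e + 7) (w j)" "w j (e + 7) = w j 0" "w j 0 = f 0" if "j < 3" for j
    using that hom face_walk[OF that] by (auto simp: is_walk_def w_def face_def)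
  have w0: "w 0 1 = f 1" "w 0 (e + 5) = f (e + 5)" "w 0 (e + 6) = f (e + 6)"
    by (simp_all add: w_def face_def add.commute)
  have w1: "w 1 1 = f (e + 6)" "w 1 2 = f (e + 5)" "w 1 (e + 4) = f (2 * e + 8)" "w 1 (e + 5) = f (2 * e + 9)"
    "w 1 (e + 6) = f (2 * e + 10)"
    by (simp_all add: w_def face_def add.commute)
  have w2: "w 2 1 = f (2 * e + 10)" "w 2 2 = f (2 * e + 9)" "w 2 3 = f (2 * e + 8)" "w 2 (e + 6) = f 1"
    by (simp_all add: w_def face_def add.commute)
  have ne: "f 1 \<noteq> f (e + 6)" "f (e + 6) \<noteq> f (2 * e + 10)" "f (2 * e + 10) \<noteq> f 1"
    using girth_cycle_no_backtrack[OF assms(1) w(1,2), of 0] girth_cycle_no_backtrack[OF assms(1) w(1,2), of 1]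
      girth_cycle_no_backtrack[OF assms(1) w(1,2), of 2] w0 w1 w2 by (auto simp: add.commute)
  have nb: "(f 0, f 1) \<in> wheel e" "(f 0, f (e + 6)) \<in> wheel e" "(f 0, f (2 * e + 10)) \<in> wheel e"
    by (intro hom; simp add: wheel_def wheel_arc_def)+
  have br: "f 0 = 1 \<Longrightarrow> w j 1 = 0 \<or> w j (e + 6) = 0"
    "f 0 = e + 5 \<Longrightarrow> w j 1 = e + 6 \<or> w j (e + 6) = e + 6"
    "f 0 = 2 * e + 8 \<Longrightarrow> w j 1 = 2 * e + 9 \<or> w j (e + 6) = 2 * e + 9" if "j < 3" for j
    using girth_cycle_at_branch[OF assms(1) w(1,2)[OF that]] w(3)[OF that] by auto
  \<comment> \<open>At a rim branch vertex the spoke neighbour \<open>q\<close> would lie in all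
    three pairs formed from three distinct values.\<close>
  have two: False if "\<And>j. j < 3 \<Longrightarrow> w j 1 = q \<or> w j (e + 6) = q" for q
    using that[of 0] that[of 1] that[of 2] ne w0 w1 w2 by (auto simp: add.commute)
  have "f 0 = 0"
  proof (rule ccontr)
    assume "f 0 \<noteq> 0"
    then consider "f 0 = 1" | "f 0 = e + 5" | "f 0 = 2 * e + 8" | "f 0 \<notin> {0, 1, e + 5, 2 * e + 8}"
      by blast
    then show False
    proof cases
      case 4
      have "f 0 < 3 * e + 13" using nb wheel_bound by blast
      from wheel_neighbours_deg2[OF this 4] obtain a b where "\<forall>y. (f 0, y) \<in> wheel e \<longrightarrow> y = a \<or> y = b" by blast
      then show False using nb ne by metis
    qed (use br two in blast)+
  qed
  have 3: "(0::nat) < 3" "(1::nat) < 3" "(2::nat) < 3" by auto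
  have w_hub: "w j 0 = 0" "w j (e + 7) = 0" if "j < 3" for j using w(2,3)[OF that] \<open>f 0 = 0\<close>
    by auto
  note H = hub_cycle_ends[OF assms(1) w(1) w_hub]
  note E0 = H(1)[OF 3(1,1,1), unfolded w0] and E1 = H(1)[OF 3(2,2,2), unfolded w1] and E2 = H(1)[OF 3(3,3,3), unfolded w2]
  \<comment> \<open>Two faces must agree along their common spoke. A spoke sent to a shorter one
    would run past its end, where the image faces separate.\<close>
  have "f (2 * e + 10) = 2 * e + 10 \<and> f (e + 6) = e + 6 \<and> f 1 = 1"
    using E2 unfolding insert_iff empty_iff prod.inject
  proof (elim disjE conjE)
  qed (use E1 E0 in auto)
  then have ends: "w j 1 = face e j 1 \<and> w j (e + 6) = face e j (e + 6)" if "j < 3" for j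
  proof -
    have "j = 0 \<or> j = 1 \<or> j = 2" using that by linarith
    then show ?thesis using \<open>_ \<and> _ \<and> f 1 = 1\<close> w0 w1 w2
      by (elim disjE) (simp_all add: face_def)
  qed
  have "w j i = face e j i" if "j < 3" "i \<le> e + 7" for j i
    using H(2)[OF that(1) that(1) that(1) that(1)] ends that by blast
  moreover obtain j i where "j < 3" "i < e + 7" "v = face e j i" using face_surj[OF assms(3)] by blast
  ultimately show ?thesis by (auto simp: w_def)
qed

lemma wheel_degree:
  assumes "v < 3 * e + 13"
  shows "card (wheel e `` {v}) = (if v \<in> {0, 1, e + 5, 2 * e + 8} then 3 else 2)"
proof -
  consider "v = 0" | "v = 1" | "1 < v" "v < e + 5" | "v = e + 5" | "v = e + 6" | "v = e + 7" | "e + 7 < v" "v < 2 * e + 8"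
    | "v = 2 * e + 8" | "v = 2 * e + 9" | "v = 2 * e + 10" | "v = 2 * e + 11" | "2 * e + 11 < v" "v < 3 * e + 12"
    | "v = 3 * e + 12"
  proof -
    have "v = 0 \<or> v = 1 \<or> 1 < v \<and> v < e + 5 \<or> v = e + 5 \<or> v = e + 6 \<or> v = e + 7 \<or> e + 7 < v" by linarith
    moreover have "v < 2 * e + 8 \<or> v = 2 * e + 8 \<or> v = 2 * e + 9 \<or> v = 2 * e + 10 \<or> v = 2 * e + 11 \<or>
      2 * e + 11 < v \<and> v < 3 * e + 12 \<or> v = 3 * e + 12" using assms by linarith
    ultimately show ?thesis using that by blast
  qed
  then show ?thesis
  proof cases
    case 1
    then have "wheel e `` {v} = {1, e + 6, 2 * e + 10}" by (auto simp: wheel_def wheel_arc_def)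
    then show ?thesis using 1 by simp
  next
    case 2
    then have "wheel e `` {v} = {0, 2, 3 * e + 12}" by (auto simp: wheel_def wheel_arc_def)
    then show ?thesis using 2 by simp
  next
    case 3
    then have "wheel e `` {v} = {v - 1, Suc v}" by (auto simp: wheel_def wheel_arc_def)
    then show ?thesis using 3 by simp
  next
    case 4
    then have "wheel e `` {v} = {e + 4, e + 6, e + 7}" by (auto simp: wheel_def wheel_arc_def)
    then show ?thesis using 4 by simp
  next
    case 5
    then have "wheel e `` {v} = {e + 5, 0}" by (auto simp: wheel_def wheel_arc_def)
    then show ?thesis using 5 by simp
  next
    case 6
    then have "wheel e `` {v} = {e + 5, e + 8}" by (auto simp: wheel_def wheel_arc_def)
    then show ?thesis using 6 by simp
  next
    case 7
    then have "wheel e `` {v} = {v - 1, Suc v}" by (auto simp: wheel_def wheel_arc_def)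
    then show ?thesis using 7 by simp
  next
    case 8
    then have "wheel e `` {v} = {2 * e + 7, 2 * e + 9, 2 * e + 11}"
      by (auto simp: wheel_def wheel_arc_def)
    then show ?thesis using 8 by simp
  next
    case 9
    then have "wheel e `` {v} = {2 * e + 8, 2 * e + 10}" by (auto simp: wheel_def wheel_arc_def)
    then show ?thesis using 9 by simp
  next
    case 10
    then have "wheel e `` {v} = {2 * e + 9, 0}" by (auto simp: wheel_def wheel_arc_def)
    then show ?thesis using 10 by simp
  next
    case 11
    then have "wheel e `` {v} = {2 * e + 8, 2 * e + 12}" by (auto simp: wheel_def wheel_arc_def)
    then show ?thesis using 11 by simp
  next
    case 12
    then have "wheel e `` {v} = {v - 1, Suc v}" by (auto simp: wheel_def wheel_arc_def)
    then show ?thesis using 12 by simp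
  next
    case 13
    then have "wheel e `` {v} = {3 * e + 11, 1}" by (auto simp: wheel_def wheel_arc_def)
    then show ?thesis using 13 by simp
  qed
qed

section \<open>Rigid systems of labels\<close>

text \<open>
  The flag \<open>\<mu>\<close> says whether the triple carrying the labels \<open>l < 3 * q\<close> satisfies \<open>y = x m\<close>. If not,
  the labels form one cycle of length \<open>3 * q\<close>, otherwise a \<open>q\<close>-cycle followed
    by a \<open>2 * q\<close>-cycle.
\<close>

definition orbit_start :: "nat \<Rightarrow> bool \<Rightarrow> nat \<Rightarrow> nat" where
  "orbit_start q \<mu> l = (if \<mu> \<and> q \<le> l then q else 0)"

definition orbit_size :: "nat \<Rightarrow> bool \<Rightarrow> nat \<Rightarrow> nat" where
  "orbit_size q \<mu> l = (if \<not> \<mu> then 3 * q else if l < q then q else 2 * q)"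

definition next_label :: "nat \<Rightarrow> bool \<Rightarrow> nat \<Rightarrow> nat" where
  "next_label q \<mu> l = orbit_start q \<mu> l + (l - orbit_start q \<mu> l + 1) mod orbit_size q \<mu> l"

text \<open>
  On every block of \<open>q\<close> labels the second permutation is the 3-cycle \<open>0, 5, 5 * d\<close>, which determines
  \<open>d\<close> and breaks the dihedral symmetry of the cycle, with two exceptions. In the \<open>3 * q\<close>-cycle
  the return to \<open>0\<close> exchanges the first two blocks, as otherwise the rotation by \<open>q\<close> would be
  an automorphism. In the \<open>2 * q\<close>-cycle the last block is fixed, as otherwise this cycle would cover the
  \<open>q\<close>-cycle.
\<close>

definition twist_label :: "nat \<Rightarrow> nat \<Rightarrow> bool \<Rightarrow> nat \<Rightarrow> nat" where
  "twist_label q d \<mu> l =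
     (if \<mu> \<and> 2 * q \<le> l then l
      else if l mod q = 0 then l + 5
      else if l mod q = 5 then l - 5 + 5 * d
      else if l mod q = 5 * d then (let z = l - 5 * d in if \<mu> then z else if z = 0 then q else if z = q then 0 else z)
      else l)"

text \<open>The identity, except that the threefold cover of the \<open>q\<close>-cycle by the
  \<open>3 * q\<close>-cycle is applied when the flag becomes true.\<close>

definition fold_label :: "nat \<Rightarrow> bool \<Rightarrow> bool \<Rightarrow> nat \<Rightarrow> nat" where
  "fold_label q \<mu> \<mu>' l = (if \<not> \<mu> \<and> \<mu>' then l mod q else l)"

section \<open>Orbits of the first permutation\<close>

lemma orbit_cases:
  assumes "l < 3 * q"
  obtains "\<not> \<mu>" "orbit_start q \<mu> l = 0" "orbit_size q \<mu> l = 3 * q"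
  | "\<mu>" "l < q" "orbit_start q \<mu> l = 0" "orbit_size q \<mu> l = q"
  | "\<mu>" "q \<le> l" "orbit_start q \<mu> l = q" "orbit_size q \<mu> l = 2 * q"
  using assms by (cases \<mu>; cases "l < q") (auto simp: orbit_start_def orbit_size_def)

lemma orbit_start_add:
  assumes "l < 3 * q" "i < orbit_size q \<mu> l"
  shows "orbit_start q \<mu> (orbit_start q \<mu> l + i) = orbit_start q \<mu> l" "orbit_size q \<mu> (orbit_start q \<mu> l + i) = orbit_size q \<mu> l"
    "orbit_start q \<mu> l + i < 3 * q"
  using assms by (cases rule: orbit_cases[of l q \<mu>]; auto simp: orbit_start_def orbit_size_def)+

lemma orbit_start_le:
  assumes "l < 3 * q"
  shows "orbit_start q \<mu> l \<le> l" "l - orbit_start q \<mu> l < orbit_size q \<mu> l" "0 < orbit_size q \<mu> l"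
  using assms by (cases rule: orbit_cases[of l q \<mu>]; auto)+

lemma next_label_range:
  assumes "l < 3 * q"
  shows "next_label q \<mu> l < 3 * q" "orbit_start q \<mu> (next_label q \<mu> l) = orbit_start q \<mu> l" "orbit_size q \<mu> (next_label q \<mu> l) = orbit_size q \<mu> l"
  unfolding next_label_def using orbit_start_add[OF assms, of _ \<mu>] orbit_start_le(3)[OF assms]
    by auto

lemma next_label_iter:
  assumes "l < 3 * q"
  shows "(next_label q \<mu> ^^ i) l = orbit_start q \<mu> l + (l - orbit_start q \<mu> l + i) mod orbit_size q \<mu> l"
proof (induction i)
  case 0
  then show ?case using orbit_start_le[OF assms, of \<mu>] by simp
next
  case (Suc i)
  have "(l - orbit_start q \<mu> l + i) mod orbit_size q \<mu> l < orbit_size q \<mu> l"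
    using orbit_start_le(3)[OF assms] by simp
  then show ?case
    using orbit_start_add[OF assms, of "(l - orbit_start q \<mu> l + i) mod orbit_size q \<mu> l" \<mu>]
    by (simp add: Suc next_label_def[of q \<mu> "_ + _"] mod_Suc_eq)
qed

lemma next_label_inj:
  assumes "a < 3 * q" "b < 3 * q" "next_label q \<mu> a = next_label q \<mu> b"
  shows "a = b"
proof -
  have o: "orbit_start q \<mu> a = orbit_start q \<mu> b" "orbit_size q \<mu> a = orbit_size q \<mu> b"
    using next_label_range[OF assms(1), of \<mu>] next_label_range[OF assms(2), of \<mu>] assms(3)
      by auto
  let ?o = "orbit_start q \<mu> b" and ?N = "orbit_size q \<mu> b"
  have "(a - ?o + 1) mod ?N = (b - ?o + 1) mod ?N" using assms(3) o by (simp add: next_label_def)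
  \<comment> \<open>Adding \<open>?N - 1\<close> undoes the successor modulo \<open>?N\<close>
    without subtraction.\<close>
  then have "(a - ?o + 1 + (?N - 1)) mod ?N = (b - ?o + 1 + (?N - 1)) mod ?N" by (metis mod_add_left_eq)
  then have "(a - ?o) mod ?N = (b - ?o) mod ?N" using orbit_start_le(3)[OF assms(2), of \<mu>] by simp
  then have "a - ?o = b - ?o"
    using orbit_start_le[OF assms(1), of \<mu>] orbit_start_le[OF assms(2), of \<mu>] o by simp
  then show ?thesis
    using orbit_start_le(1)[OF assms(1), of \<mu>] orbit_start_le(1)[OF assms(2), of \<mu>] o by simp
qed

text \<open>Starts and lengths of the orbits are multiples of 5, so wrapping around does not disturb
  residues. The residues later separate \<open>step\<close> from \<open>link\<close>.\<close>

lemma next_label_mod5: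
  assumes "q = 5 * u" "l < 3 * q"
  shows "next_label q \<mu> l mod 5 = (l + 1) mod 5"
proof -
  have "orbit_start q \<mu> l mod 5 = 0" "5 dvd orbit_size q \<mu> l" using assms
    by (auto simp: orbit_start_def orbit_size_def)
  then have "next_label q \<mu> l mod 5 = (l - orbit_start q \<mu> l + 1) mod 5"
    by (simp add: next_label_def mod_add_left_eq[of "orbit_start q \<mu> l", symmetric] mod_mod_cancel)
  also have "\<dots> = (orbit_start q \<mu> l + (l - orbit_start q \<mu> l + 1)) mod 5"
    using \<open>orbit_start q \<mu> l mod 5 = 0\<close> by (metis add.left_neutral mod_add_left_eq)
  also have "orbit_start q \<mu> l + (l - orbit_start q \<mu> l + 1) = l + 1"
    using orbit_start_le(1)[OF assms(2), of \<mu>] by simp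
  finally show ?thesis .
qed

section \<open>The second permutation\<close>

lemma less_3q_cases:
  fixes l q :: nat assumes "l < 3 * q"
  obtains c r where "c < 3" "r < q" "l = c * q + r" "l mod q = r"
proof (rule that)
  have q: "0 < q" using assms by auto
  show "l div q < 3" using assms q by (simp add: less_mult_imp_div_less)
  show "l mod q < q" using q by simp
qed simp_all

lemma twist_label_moved:
  assumes "twist_label q d \<mu> l \<noteq> l"
  shows "l mod q \<in> {0, 5, 5 * d}" "\<not> (\<mu> \<and> 2 * q \<le> l)"
  using assms by (auto simp: twist_label_def Let_def split: if_splits)

lemma twist_label_eqs:
  assumes "3 \<le> d" "5 * d < q" "c < 3"
  shows "twist_label q d \<mu> (c * q) = (if \<mu> \<and> c = 2 then c * q else c * q + 5)"
    "twist_label q d \<mu> (c * q + 5) = (if \<mu> \<and> c = 2 then c * q + 5 else c * q + 5 * d)"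
    "twist_label q d \<mu> (c * q + 5 * d) =
       (if \<mu> then (if c = 2 then c * q + 5 * d else c * q) else if c = 0 then q else if c = 1 then 0 else c * q)"
    "r < q \<Longrightarrow> r \<noteq> 0 \<Longrightarrow> r \<noteq> 5 \<Longrightarrow> r \<noteq> 5 * d \<Longrightarrow> twist_label q d \<mu> (c * q + r) = c * q + r"
proof -
  have m: "r < q \<Longrightarrow> (c * q + r) mod q = r" for r by simp
  have c: "c = 0 \<or> c = 1 \<or> c = 2" using assms by linarith
  show "twist_label q d \<mu> (c * q) = (if \<mu> \<and> c = 2 then c * q else c * q + 5)"
    using c assms by (elim disjE) (simp_all add: twist_label_def)
  show "twist_label q d \<mu> (c * q + 5) = (if \<mu> \<and> c = 2 then c * q + 5 else c * q + 5 * d)"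
    using c assms by (elim disjE) (simp_all add: twist_label_def)
  show "twist_label q d \<mu> (c * q + 5 * d) =
       (if \<mu> then (if c = 2 then c * q + 5 * d else c * q) else if c = 0 then q else if c = 1 then 0 else c * q)"
    using c assms by (elim disjE) (simp_all add: twist_label_def Let_def)
  show "r < q \<Longrightarrow> r \<noteq> 0 \<Longrightarrow> r \<noteq> 5 \<Longrightarrow> r \<noteq> 5 * d \<Longrightarrow> twist_label q d \<mu> (c * q + r) = c * q + r"
    using m by (simp add: twist_label_def)
qed

text \<open>Modulo \<open>q\<close> the exchange of the first two blocks disappears, and the folded
  label lies in the first block, away from the fixed last one.\<close>

lemma twist_label_fold_label:
  assumes "3 \<le> d" "5 * d < q" "l < 3 * q" "\<mu> \<longrightarrow> \<mu>'"
  shows "fold_label q \<mu> \<mu>' (twist_label q d \<mu> l) = twist_label q d \<mu>' (fold_label q \<mu> \<mu>' l)"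
proof (cases "\<not> \<mu> \<and> \<mu>'")
  case True
  obtain c r where l: "c < 3" "r < q" "l = c * q + r" "l mod q = r" by (rule less_3q_cases[OF assms(3)])
  have "twist_label q d False l mod q = twist_label q d True (l mod q)"
  proof -
    consider "r = 0" | "r = 5" | "r = 5 * d" | "r \<noteq> 0" "r \<noteq> 5" "r \<noteq> 5 * d" by blast
    then show ?thesis
    proof cases
      case 1
      then show ?thesis
        using twist_label_eqs(1)[OF assms(1,2) l(1), of False] twist_label_eqs(1)[OF assms(1,2), of 0 True] l assms by simp
    next
      case 2
      then show ?thesis
        using twist_label_eqs(2)[OF assms(1,2) l(1), of False] twist_label_eqs(2)[OF assms(1,2), of 0 True] l assms by simp
    next
      case 3
      then show ?thesis
        using twist_label_eqs(3)[OF assms(1,2) l(1), of False] twist_label_eqs(3)[OF assms(1,2), of 0 True] l assms by simp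
    next
      case 4
      then show ?thesis
        using twist_label_eqs(4)[OF assms(1,2) l(1), of r False] twist_label_eqs(4)[OF assms(1,2), of 0 r True] l assms by simp
    qed
  qed
  then show ?thesis using True by (simp add: fold_label_def)
next
  case False
  then have "\<mu> = \<mu>'" using assms by auto
  then show ?thesis by (simp add: fold_label_def)
qed

lemma next_label_fold_label:
  assumes "l < 3 * q" "\<mu> \<longrightarrow> \<mu>'"
  shows "fold_label q \<mu> \<mu>' (next_label q \<mu> l) = next_label q \<mu>' (fold_label q \<mu> \<mu>' l)"
proof (cases "\<not> \<mu> \<and> \<mu>'")
  case True
  then have "l mod q < q" using assms by (metis mod_less_divisor mult_0_right not_gr_zero not_less_zero)
  then show ?thesis using True
    by (simp add: fold_label_def next_label_def orbit_start_def orbit_size_def mod_mod_cancel mod_Suc_eq)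
next
  case False
  then have "\<mu> = \<mu>'" using assms by auto
  then show ?thesis by (simp add: fold_label_def)
qed

lemma twist_label_range_mod5:
  assumes "3 \<le> d" "5 * d < q" "q = 5 * u" "l < 3 * q"
  shows "twist_label q d \<mu> l < 3 * q" "twist_label q d \<mu> l mod 5 = l mod 5" "orbit_start q \<mu> (twist_label q d \<mu> l) = orbit_start q \<mu> l"
proof -
  obtain c r where l: "c < 3" "r < q" "l = c * q + r" "l mod q = r" by (rule less_3q_cases[OF assms(4)])
  have c: "c = 0 \<or> c = 1 \<or> c = 2" using l by linarith
  have "twist_label q d \<mu> l < 3 * q \<and> twist_label q d \<mu> l mod 5 = l mod 5 \<and> orbit_start q \<mu> (twist_label q d \<mu> l) = orbit_start q \<mu> l"
  proof -
    consider "r = 0" | "r = 5" | "r = 5 * d" | "r \<noteq> 0" "r \<noteq> 5" "r \<noteq> 5 * d" by blast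
    then show ?thesis
    proof cases
      case 1
      then show ?thesis using twist_label_eqs(1)[OF assms(1,2) l(1), of \<mu>] l assms c
        by (auto simp: orbit_start_def)
    next
      case 2
      then show ?thesis using twist_label_eqs(2)[OF assms(1,2) l(1), of \<mu>] l assms c
        by (auto simp: orbit_start_def)
    next
      case 3
      then show ?thesis using twist_label_eqs(3)[OF assms(1,2) l(1), of \<mu>] l assms c
        by (auto simp: orbit_start_def)
    next
      case 4
      then show ?thesis using twist_label_eqs(4)[OF assms(1,2) l(1), of r \<mu>] l assms by simp
    qed
  qed
  then show "twist_label q d \<mu> l < 3 * q" "twist_label q d \<mu> l mod 5 = l mod 5" "orbit_start q \<mu> (twist_label q d \<mu> l) = orbit_start q \<mu> l" by auto
qed

lemma twist_label_inj:
  assumes "3 \<le> d" "5 * d < q" "a < 3 * q" "b < 3 * q" "twist_label q d \<mu> a = twist_label q d \<mu> b"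
  shows "a = b"
proof -
  \<comment> \<open>All cycles have length 1, 3 or 6: the exchange joins the 3-cycles of the first
    two blocks to \<open>0, 5, 5 * d, q, q + 5, q + 5 * d\<close>.\<close>
  have *: "(twist_label q d \<mu> ^^ 6) l = l" if l3: "l < 3 * q" for l
  proof -
    obtain c r where l: "c < 3" "r < q" "l = c * q + r" "l mod q = r" by (rule less_3q_cases[OF l3])
    have c: "c = 0 \<or> c = 1 \<or> c = 2" using l by linarith
    note T = twist_label_eqs(1-3)[OF assms(1,2), of 0 \<mu>, simplified] twist_label_eqs(1-3)[OF assms(1,2), of 1 \<mu>, simplified]
      twist_label_eqs(1-3)[OF assms(1,2), of 2 \<mu>, simplified]
    consider "r = 0" | "r = 5" | "r = 5 * d" | "r \<noteq> 0" "r \<noteq> 5" "r \<noteq> 5 * d" by blast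
    then show ?thesis
    proof cases
      case 1
      then show ?thesis using l c T by (cases \<mu>) (auto simp: eval_nat_numeral)
    next
      case 2
      then show ?thesis using l c T by (cases \<mu>) (auto simp: eval_nat_numeral)
    next
      case 3
      then show ?thesis using l c T by (cases \<mu>) (auto simp: eval_nat_numeral)
    next
      case 4
      then have "twist_label q d \<mu> l = l" using twist_label_eqs(4)[OF assms(1,2) l(1), of r \<mu>] l
        by simp
      then show ?thesis by (simp add: eval_nat_numeral)
    qed
  qed
  have "(twist_label q d \<mu> ^^ 6) a = (twist_label q d \<mu> ^^ 6) b"
    using assms(5) by (simp only: numeral_eq_Suc pred_numeral_simps funpow_Suc_right o_apply)
  then show ?thesis using * assms by metis
qed

lemma next_label_at:
  assumes "l < 3 * q"
  shows "next_label q \<mu> (orbit_start q \<mu> l + x mod orbit_size q \<mu> l) = orbit_start q \<mu> l + Suc x mod orbit_size q \<mu> l"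
  using orbit_start_add[OF assms, of "x mod orbit_size q \<mu> l" \<mu>] orbit_start_le(3)[OF assms, of \<mu>]
  by (simp add: next_label_def[of q \<mu> "_ + _"] mod_Suc_eq)

text \<open>
  If \<open>b\<close> holds, then \<open>S\<close> reverses the two permutations; this is what an endomorphism does that exchanges
  the two sides of the bipartition.
\<close>

lemma label_rigid:
  assumes d: "3 \<le> d" "3 \<le> d'" "5 * d + 5 * d' + 10 < q" and l0: "l0 < 3 * q"
    and rng: "\<And>l. l < 3 * q \<Longrightarrow> orbit_start q \<mu> l = orbit_start q \<mu> l0 \<Longrightarrow> S l < 3 * q"
    and fwd: "\<And>l. \<not> b \<Longrightarrow> l < 3 * q \<Longrightarrow> orbit_start q \<mu> l = orbit_start q \<mu> l0 \<Longrightarrow>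
      S (next_label q \<mu> l) = next_label q \<mu>' (S l) \<and> S (twist_label q d \<mu> l) = twist_label q d' \<mu>' (S l)"
    and bwd: "\<And>l. b \<Longrightarrow> l < 3 * q \<Longrightarrow> orbit_start q \<mu> l = orbit_start q \<mu> l0 \<Longrightarrow>
      S l = next_label q \<mu>' (S (next_label q \<mu> l)) \<and> S l = twist_label q d' \<mu>' (S (twist_label q d \<mu> l))"
  shows "\<not> b \<and> d = d' \<and> (\<mu> \<longrightarrow> \<mu>') \<and> S l0 = fold_label q \<mu> \<mu>' l0"
proof -
  define o1 N where "o1 = orbit_start q \<mu> l0" and "N = orbit_size q \<mu> l0"
  \<comment> \<open>\<open>P\<close> runs through the orbit of \<open>l0\<close> from its start,
    with period \<open>N\<close>. Below, \<open>o2\<close> and \<open>N2\<close> are start and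
    length of the target orbit, and \<open>a\<close> is the offset of \<open>S (P 0)\<close> in
    it.\<close>
  define P where "P i = o1 + i mod N" for i
  have q: "0 < q" using d by simp
  have P: "P i < 3 * q" "orbit_start q \<mu> (P i) = o1" "next_label q \<mu> (P i) = P (Suc i)" for i
    using orbit_start_add[OF l0, of "i mod N" \<mu>] orbit_start_le(3)[OF l0, of \<mu>] next_label_at[OF l0, of \<mu> i]
    by (auto simp: P_def o1_def N_def)
  have SP: "S (P i) < 3 * q" for i using rng P by (simp add: o1_def)
  define o2 N2 a where "o2 = orbit_start q \<mu>' (S (P 0))" and "N2 = orbit_size q \<mu>' (S (P 0))"
    and "a = S (P 0) - o2"
  have a: "a < N2" "S (P 0) = o2 + a" using orbit_start_le[OF SP[of 0], of \<mu>']
    by (auto simp: a_def o2_def N2_def)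
  have N2: "0 < N2" using a by simp
  have at2: "next_label q \<mu>' (o2 + x mod N2) = o2 + Suc x mod N2" "o2 + x mod N2 < 3 * q" for x
    using next_label_at[OF SP[of 0], of \<mu>' x] orbit_start_add(3)[OF SP[of 0], of "x mod N2" \<mu>'] N2 by (auto simp: o2_def N2_def)
  have F: "S (P i) = o2 + (a + i) mod N2" if "\<not> b" for i
  proof (induction i)
    case 0 then show ?case using a by simp
  next
    case (Suc i)
    then show ?case using fwd[OF that P(1), of i] P[of i] at2 by (simp add: o1_def)
  qed
  \<comment> \<open>The reversed map runs backwards, to offset \<open>a - i\<close>; the summand
    \<open>N2 * i\<close> keeps the subtraction of natural numbers exact.\<close>
  have B: "S (P i) = o2 + (a + N2 * i - i) mod N2" if "b" for i
  proof (induction i)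
    case 0 then show ?case using a by simp
  next
    case (Suc i)
    have "i \<le> N2 * i" using N2 by simp
    then have e: "Suc (a + N2 * Suc i - Suc i) = a + N2 * i - i + N2"
      using N2 \<open>i \<le> N2 * i\<close> unfolding mult_Suc_right by linarith
    have "next_label q \<mu>' (S (P (Suc i))) = S (P i)" using bwd[OF that P(1), of i] P[of i]
      by (simp add: o1_def)
    also have "\<dots> = o2 + Suc (a + N2 * Suc i - Suc i) mod N2" unfolding e using Suc by simp
    also have "\<dots> = next_label q \<mu>' (o2 + (a + N2 * Suc i - Suc i) mod N2)" using at2(1)
      by metis
    finally show ?case using next_label_inj SP at2(2) by metis
  qed
  have dq: "5 * d < q" "5 * d' < q" using d by auto
  have qN: "q dvd N" "q dvd o1" "q dvd N2"
    by (auto simp: N_def N2_def o1_def orbit_size_def orbit_start_def)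
  have qle: "q \<le> N2" using qN(3) N2 by (auto dest: dvd_imp_le)
  have Pmod: "P i mod q = i mod q" for i
  proof -
    have "P i mod q = (i mod N) mod q" using qN(2) by (auto simp: P_def elim: dvdE)
    then show ?thesis using qN(1) by (simp add: mod_mod_cancel)
  qed
  have o2: "o2 = 0 \<or> o2 = q" by (auto simp: o2_def orbit_start_def)
  \<comment> \<open>Fixed points of the second permutation go to fixed points. So a label with a
    moved image is itself moved, which restricts its place in its block and keeps it out of the
    fixed last block.\<close>
  have K: "i mod q \<in> {0, 5, 5 * d} \<and> \<not> (\<mu> \<and> 2 * q \<le> P i)"
    if "S (P i) = o2 + x" "x \<in> {0, 5, 5 * d'}" for i x
  proof -
    have "twist_label q d' \<mu>' (S (P i)) \<noteq> S (P i)"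
      using twist_label_eqs(1-3)[OF d(2) dq(2), of 0 \<mu>'] twist_label_eqs(1-3)[OF d(2) dq(2), of 1 \<mu>'] that o2 d q
      by (auto split: if_splits)
    moreover have "twist_label q d' \<mu>' (S (P i)) = S (P i)" if t: "twist_label q d \<mu> (P i) = P i"
    proof -
      have o: "orbit_start q \<mu> (P i) = orbit_start q \<mu> l0" using P(2)[of i] by (simp add: o1_def)
      show ?thesis
      proof (cases b)
        case True
        show ?thesis using bwd[OF True P(1) o, unfolded t] by argo
      next
        case False
        show ?thesis using fwd[OF False P(1) o, unfolded t] by argo
      qed
    qed
    ultimately have "twist_label q d \<mu> (P i) \<noteq> P i" by blast
    from twist_label_moved[OF this] show ?thesis by (simp add: Pmod)
  qed
  have xl: "x < N2" if "x \<in> {0, 5, 5 * d'}" for x using that d dq qle by auto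
  \<comment> \<open>Otherwise a reflection modulo \<open>q\<close> would map
    \<open>{0, 5, 5 * d'}\<close> into \<open>{0, 5, 5 * d}\<close>; the lower bounds on
    \<open>d\<close>, \<open>d'\<close> and \<open>q\<close> exclude each possible value of
    \<open>a mod q\<close>.\<close>
  have "\<not> b"
  proof
    assume b
    have KB: "(a + (N2 - x)) mod q \<in> {0, 5, 5 * d}" if x: "x \<in> {0, 5, 5 * d'}" for x
    proof -
      \<comment> \<open>The index at which the backward walk reaches offset
        \<open>x\<close>.\<close>
      define i where "i = a + (N2 - x)"
      have i: "i = a + (N2 - x)" "0 < i" using xl[OF x] by (simp_all add: i_def)
      have "N2 \<le> N2 * i" using i(2) by (cases i) simp_all
      then have "a + N2 * i - i = N2 * i - N2 + x" using xl[OF x] i(1) by linarith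
      moreover have "N2 * i - N2 = N2 * (i - 1)" by (simp add: diff_mult_distrib2)
      ultimately have "S (P i) = o2 + x" using B[OF \<open>b\<close>, of i] xl[OF x] by simp
      from K[OF this x] show ?thesis by (simp add: i_def)
    qed
    have r: "(a + (N2 - x)) mod q = (a mod q + (q - x)) mod q" if "x \<in> {0, 5, 5 * d'}" for x
    proof -
      obtain n where "N2 = q * n" using qN(3) by blast
      then obtain m where m: "N2 = q * m + q" using N2 by (cases n) auto
      have "x \<le> q" using that d dq by auto
      then have "a + (N2 - x) = (a + (q - x)) + q * m" using m by simp
      then have "(a + (N2 - x)) mod q = (a + (q - x)) mod q" by (simp only: mod_mult_self2)
      then show ?thesis by (simp add: mod_add_left_eq)
    qed
    have "a mod q \<in> {0, 5, 5 * d}" using KB[of 0] r[of 0] by simp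
    then consider "a mod q = 0" | "a mod q = 5" | "a mod q = 5 * d" by auto
    then show False
    proof cases
      case 1
      then show False using KB[of 5] r[of 5] d by auto
    next
      case 2
      have "5 + (q - 5 * d') < q" "5 * d < 5 + (q - 5 * d')" using d by auto
      then show False using KB[of "5 * d'"] r[of "5 * d'"] 2 d by auto
    next
      case 3
      have "5 * d + (q - 5) = q + (5 * d - 5)" using d dq by simp
      moreover have "5 * d - 5 < q" using dq by simp
      ultimately have "(5 * d + (q - 5)) mod q = 5 * d - 5" by (simp only: mod_add_self1 mod_less)
      then show False using KB[of 5] r[of 5] 3 d by auto
    qed
  qed
  note F = F[OF this] and fwd = fwd[OF this]
  have KF: "(N2 - a + x) mod q \<in> {0, 5, 5 * d}" if x: "x \<in> {0, 5, 5 * d'}" for x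
  proof -
    have "S (P (N2 - a + x)) = o2 + x" using F[of "N2 - a + x"] a xl[OF x] by simp
    from K[OF this x] show ?thesis by simp
  qed
  define r where "r = (N2 - a) mod q"
  have KF': "(r + x) mod q \<in> {0, 5, 5 * d}" if "x \<in> {0, 5, 5 * d'}" for x
    using KF[OF that] by (simp add: r_def mod_add_left_eq)
  have r: "r < q" using q by (simp add: r_def)
  \<comment> \<open>Now a translation modulo \<open>q\<close> maps one set into the other. For
    \<open>r = 5\<close> the label \<open>10\<close>, and for \<open>r = 5 * d\<close> the label
    \<open>5 * d + 5\<close>, would have to belong to \<open>{0, 5, 5 * d}\<close>.\<close>
  have "r = 0 \<and> d = d'"
  proof -
    have "r \<in> {0, 5, 5 * d}" using KF'[of 0] r by simp
    then consider "r = 0" | "r = 5" | "r = 5 * d" by auto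
    then show ?thesis
    proof cases
      case 1
      then show ?thesis using KF'[of "5 * d'"] dq d by auto
    next
      case 2
      then show ?thesis using KF'[of 5] d by auto
    next
      case 3
      then show ?thesis using KF'[of 5] d by auto
    qed
  qed
  then have "q dvd N2 - a" "d = d'" by (auto simp: r_def)
  then have "q dvd a" using qN(3) a(1) by (metis dvd_diffD1 less_imp_le)
  then obtain c where c: "a = c * q" by (metis dvdE mult.commute)
  \<comment> \<open>When the source orbit closes, so does its image; hence the target length divides
    the source length.\<close>
  have "P N = P 0" by (simp add: P_def)
  then have "(a + N) mod N2 = a mod N2" using F[of N] F[of 0] by simp
  then have dv: "N2 dvd N" using mod_eq_dvd_iff_nat[of a "a + N" N2] by simp
  have Sl: "S l0 = o2 + (a + (l0 - o1)) mod N2"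
  proof -
    have "P (l0 - o1) = l0" using orbit_start_le[OF l0, of \<mu>] by (simp add: P_def o1_def N_def)
    then show ?thesis using F[of "l0 - o1"] by simp
  qed
  \<comment> \<open>A label sent to the start of the target orbit is not in the fixed last block.
    This keeps the \<open>2 * q\<close>-cycle from covering the \<open>q\<close>-cycle and from
    being rotated by \<open>q\<close>.\<close>
  have no_wrap: "\<not> (\<mu> \<and> 2 * q \<le> P i)" if "(a + i) mod N2 = 0" for i
    using K[of i 0] F[of i] that by simp
  have "(\<mu> \<longrightarrow> \<mu>') \<and> S l0 = fold_label q \<mu> \<mu>' l0"
  proof (cases rule: orbit_cases[OF l0, of \<mu>])
    case 1
    then have s: "o1 = 0" "N = 3 * q" by (auto simp: o1_def N_def)
    show ?thesis
    proof (cases rule: orbit_cases[OF SP[of 0], of \<mu>'])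
      case t: 1
      then have o: "o2 = 0" "N2 = 3 * q" by (auto simp: o2_def N2_def)
      have "c < 3" using a(1) c o q by simp
      \<comment> \<open>The offsets \<open>a = q\<close> and \<open>a = 2 * q\<close> fail at the
        return from \<open>5 * d\<close> to \<open>q\<close>: the corresponding return from the
        second block goes to \<open>0\<close>, that from the third block to its own start.\<close>
      have "S (twist_label q d \<mu> (5 * d)) = twist_label q d \<mu>' (S (5 * d))"
        using fwd[of "5 * d"] dq d \<open>d = d'\<close> 1 by (auto simp: orbit_start_def)
      moreover have "twist_label q d \<mu> (5 * d) = q"
        using twist_label_eqs(3)[OF d(1) dq(1), of 0 \<mu>] 1 by simp
      moreover have "S (5 * d) = a + 5 * d" if "a = 0 \<or> a = q \<or> a = 2 * q"
        using F[of "5 * d"] o s dq that by (auto simp: P_def)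
      moreover have "S q = a + q" if "a = 0 \<or> a = q"
        using F[of q] o s q that by (auto simp: P_def)
      moreover have "S q = 0" if "a = 2 * q"
        using F[of q] o s q that by (auto simp: P_def)
      ultimately have "a = 0"
        using twist_label_eqs(3)[OF d(1) dq(1), of 1 \<mu>'] twist_label_eqs(3)[OF d(1) dq(1), of 2 \<mu>'] t c \<open>c < 3\<close> q
        by (auto simp: less_Suc_eq numeral_3_eq_3 add.commute)
      then show ?thesis using 1 t s o Sl l0 by (simp add: fold_label_def)
    next
      case t: 2
      then have "o2 = 0" "N2 = q" by (auto simp: o2_def N2_def)
      then show ?thesis using 1 t s Sl c a(1) by (simp add: fold_label_def)
    next
      case t: 3
      then have "N2 = 2 * q" by (auto simp: N2_def)
      then have "2 * q dvd 3 * q" using dv s by simp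
      then show ?thesis using q by auto
    qed
  next
    case 2
    then have s: "o1 = 0" "N = q" by (auto simp: o1_def N_def)
    have "N2 \<le> q" using dv s q by (auto dest: dvd_imp_le)
    then show ?thesis
    proof (cases rule: orbit_cases[OF SP[of 0], of \<mu>'])
      case t: 2
      then have "o2 = 0" "N2 = q" by (auto simp: o2_def N2_def)
      then show ?thesis using 2 t s Sl c a(1) by (simp add: fold_label_def)
    qed (use q in \<open>auto simp: N2_def\<close>)
  next
    case 3
    then have s: "o1 = q" "N = 2 * q" by (auto simp: o1_def N_def)
    have "N2 \<le> 2 * q" using dv s q by (auto dest: dvd_imp_le)
    then show ?thesis
    proof (cases rule: orbit_cases[OF SP[of 0], of \<mu>'])
      case 1
      then show ?thesis using \<open>N2 \<le> 2 * q\<close> q by (auto simp: N2_def)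
    next
      case t: 2
      then have "N2 = q" by (auto simp: N2_def)
      then have "(a + q) mod N2 = 0" using c by simp
      from no_wrap[OF this] show ?thesis using 3 s q by (simp add: P_def)
    next
      case t: 3
      then have o: "o2 = q" "N2 = 2 * q" by (auto simp: o2_def N2_def)
      have "c = 0 \<or> c = 1" using a(1) c o q by auto
      moreover have "c \<noteq> 1"
      proof
        assume "c = 1"
        then have "a + q = N2" using c o by simp
        then have "(a + q) mod N2 = 0" by simp
        from no_wrap[OF this] show False using 3 s q by (simp add: P_def)
      qed
      ultimately have "a = 0" using c by simp
      then show ?thesis using 3 t s o Sl l0 by (simp add: fold_label_def)
    qed
  qed
  then show ?thesis using \<open>\<not> b\<close> \<open>d = d'\<close> by blast
qed

section \<open>Walks, degrees and endomorphisms of pair digraphs\<close>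

text \<open>Cycles are arc lists, whereas the arguments on walks use vertex sequences; this and
  \<open>cas_map_upt\<close> translate between the two.\<close>

lemma (in pre_digraph) cas_nth:
  assumes "cas u p v"
  shows "\<exists>w. w 0 = u \<and> w (length p) = v \<and> (\<forall>i<length p. tail G (p ! i) = w i \<and> head G (p ! i) = w (Suc i))"
  using assms
proof (induction u p v rule: cas.induct)
  case (1 u v)
  then show ?case by auto
next
  case (2 u a es v)
  then obtain w where "w 0 = head G a" "w (length es) = v"
    "\<forall>i<length es. tail G (es ! i) = w i \<and> head G (es ! i) = w (Suc i)" by auto
  then show ?case using 2(2)
    by (intro exI[of _ "case_nat u w"]) (auto simp: nth_Cons split: nat.splits)
qed

lemma (in pre_digraph) cas_map_upt:
  assumes "\<And>i. i < n \<Longrightarrow> tail G (p i) = w i \<and> head G (p i) = w (Suc i)" "k \<le> n"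
  shows "cas (w k) (map p [k..<n]) (w n)"
  using assms(2)
proof (induction "n - k" arbitrary: k)
  case 0
  then show ?case by simp
next
  case (Suc m)
  then have "k < n" by auto
  then show ?case using Suc(1)[of "Suc k"] Suc(2) assms(1) by (simp add: upt_conv_Cons)
qed

lemma odd_girth_eqI:
  fixes E :: "('v \<times> 'v) set"
  assumes "finite V" "E \<subseteq> V \<times> V" "odd g"
    and girth: "\<And>n w. is_walk E n w \<Longrightarrow> w n = w 0 \<Longrightarrow> odd n \<Longrightarrow> g \<le> n"
    and c: "is_walk E g c" "c g = c 0" "inj_on c {..<g}"
  shows "odd_girth \<lparr>pverts = V, parcs = E\<rparr> = enat g"
proof -
  let ?G = "with_proj \<lparr>pverts = V, parcs = E\<rparr>"
  have G: "verts ?G = V" "arcs ?G = E" "tail ?G = fst" "head ?G = snd" by (auto simp: with_proj_def)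
  let ?C = "{p. pre_digraph.cycle ?G p \<and> odd (length p)}"
  have lb: "g \<le> length p" if "p \<in> ?C" for p
  proof -
    obtain u where "pre_digraph.awalk ?G u p u" using \<open>p \<in> ?C\<close>
      by (auto simp: pre_digraph.cycle_def)
    then have "pre_digraph.cas ?G u p u" and p: "set p \<subseteq> E"
      by (auto simp: pre_digraph.awalk_def G)
    from pre_digraph.cas_nth[OF this(1)] obtain w where w: "w 0 = u" "w (length p) = u"
      "\<forall>i<length p. fst (p ! i) = w i \<and> snd (p ! i) = w (Suc i)" by (auto simp: G)
    have "is_walk E (length p) w"
      unfolding is_walk_def
    proof (intro allI impI)
      fix i assume "i < length p"
      then have "p ! i \<in> E" "p ! i = (w i, w (Suc i))" using p w(3) by (auto simp: prod_eq_iff)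
      then show "(w i, w (Suc i)) \<in> E" by simp
    qed
    then show ?thesis using girth[of "length p" w] w \<open>p \<in> ?C\<close> by auto
  qed
  define p where "p = map (\<lambda>i. (c i, c (Suc i))) [0..<g]"
  have g: "0 < g" using assms(3) by (rule odd_pos)
  have "pre_digraph.cas ?G (c 0) p (c g)"
    unfolding p_def by (rule pre_digraph.cas_map_upt) (auto simp: G)
  moreover have "set p \<subseteq> E" using c(1) by (auto simp: p_def is_walk_def)
  moreover have "c 0 \<in> V" using c(1) g assms(2) by (auto simp: is_walk_def)
  ultimately have aw: "pre_digraph.awalk ?G (c 0) p (c 0)" using c(2)
    by (simp add: pre_digraph.awalk_def G)
  have "pre_digraph.awalk_verts ?G (c 0) p = map c [0..<g] @ [c g]"
    using g by (simp add: pre_digraph.awalk_verts_conv p_def G last_map o_def)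
  \<comment> \<open>A cycle is tested without the first vertex of its list; the final vertex
    \<open>c g = c 0\<close> takes its place.\<close>
  also have "tl \<dots> = map c [1..<g] @ [c 0]" using g c(2) by (simp add: upt_conv_Cons)
  finally have "distinct (tl (pre_digraph.awalk_verts ?G (c 0) p)) \<longleftrightarrow> distinct (c 0 # map c [1..<g])"
    by auto
  also have "c 0 # map c [1..<g] = map c [0..<g]" using g by (simp add: upt_conv_Cons)
  also have "distinct \<dots>" using c(3) by (simp add: distinct_map atLeast0LessThan)
  finally have "pre_digraph.cycle ?G p" using aw g unfolding pre_digraph.cycle_def by (auto simp: p_def)
  then have "p \<in> ?C" using assms(3) by (simp add: p_def)
  have "odd_girth \<lparr>pverts = V, parcs = E\<rparr> \<le> enat g"
    unfolding odd_girth_def by (rule INF_lower2[OF \<open>p \<in> ?C\<close>]) (simp add: p_def)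
  moreover have "enat g \<le> odd_girth \<lparr>pverts = V, parcs = E\<rparr>"
    unfolding odd_girth_def by (rule INF_greatest) (use lb in auto)
  ultimately show ?thesis by (rule antisym)
qed

lemma pair_graphI:
  assumes "finite V" "E \<subseteq> V \<times> V" "sym E" "irrefl E"
  shows "pair_graph \<lparr>pverts = V, parcs = E\<rparr>"
proof -
  have "finite E" using assms(1,2) by (meson finite_SigmaI finite_subset)
  then show ?thesis
    using assms by unfold_locales
      (auto simp: irrefl_def symmetric_def sym_def arcs_ends_def arc_to_ends_def with_proj_def)
qed

lemma out_degree_pair: "out_degree (with_proj \<lparr>pverts = V, parcs = E\<rparr>) v = card (E `` {v})"
proof -
  have "out_arcs (with_proj \<lparr>pverts = V, parcs = E\<rparr>) v = Pair v ` (E `` {v})"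
    by (auto simp: out_arcs_def with_proj_def)
  then show ?thesis by (simp add: out_degree_def card_image inj_on_def)
qed

section \<open>Identifying endomorphism monoids\<close>

lemma End_monoid_iso:
  fixes M :: "('a, 'm) monoid_scheme" and E :: "('v \<times> 'v) set"
  assumes "monoid M" "E \<subseteq> V \<times> V"
    and act: "\<And>f v. f \<in> carrier M \<Longrightarrow> v \<in> V \<Longrightarrow> act f v \<in> V"
      "\<And>f u v. f \<in> carrier M \<Longrightarrow> (u, v) \<in> E \<Longrightarrow> (act f u, act f v) \<in> E"
      "\<And>f h v. f \<in> carrier M \<Longrightarrow> h \<in> carrier M \<Longrightarrow> v \<in> V \<Longrightarrow> act (f \<otimes>\<^bsub>M\<^esub> h) v = act f (act h v)"
    and inj: "\<And>f h. f \<in> carrier M \<Longrightarrow> h \<in> carrier M \<Longrightarrow> (\<And>v. v \<in> V \<Longrightarrow> act f v = act h v) \<Longrightarrow> f = h"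
    and surj: "\<And>\<phi>. \<phi> \<in> V \<rightarrow> V \<Longrightarrow> (\<And>u v. (u, v) \<in> E \<Longrightarrow> (\<phi> u, \<phi> v) \<in> E) \<Longrightarrow>
      \<exists>f\<in>carrier M. \<forall>v\<in>V. \<phi> v = act f v"
  shows "End_monoid \<lparr>pverts = V, parcs = E\<rparr> \<cong> M"
proof -
  interpret monoid M by fact
  let ?G = "\<lparr>pverts = V, parcs = E\<rparr>"
  define A where "A f = restrict (act f) V" for f
  have A_in: "A f \<in> graph_endos ?G" if "f \<in> carrier M" for f
    using act(1,2)[OF that] assms(2) by (auto simp: A_def graph_endos_def)
  have A_inj: "f = h" if "f \<in> carrier M" "h \<in> carrier M" "A f = A h" for f h
    using inj[OF that(1,2)] that(3) by (metis A_def restrict_apply')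
  have A_surj: "\<exists>f\<in>carrier M. \<phi> = A f" if "\<phi> \<in> graph_endos ?G" for \<phi>
  proof -
    have "\<phi> \<in> V \<rightarrow>\<^sub>E V" "\<And>u v. (u, v) \<in> E \<Longrightarrow> (\<phi> u, \<phi> v) \<in> E" using that by (auto simp: graph_endos_def)
    moreover from this obtain f where "f \<in> carrier M" "\<forall>v\<in>V. \<phi> v = act f v"
      using surj[of \<phi>] by (auto simp: PiE_iff)
    ultimately show ?thesis by (intro bexI[of _ f]) (auto simp: A_def fun_eq_iff PiE_iff extensional_def)
  qed
  have A_mult: "compose V (A f) (A h) = A (f \<otimes>\<^bsub>M\<^esub> h)"
    if "f \<in> carrier M" "h \<in> carrier M" for f h
    using that act by (auto simp: A_def compose_def fun_eq_iff)
  have bij: "bij_betw A (carrier M) (graph_endos ?G)"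
    unfolding bij_betw_def inj_on_def using A_in A_inj A_surj by (auto simp: image_iff) 
  define B where "B = the_inv_into (carrier M) A"
  have B: "bij_betw B (graph_endos ?G) (carrier M)"
    unfolding B_def by (rule bij_betw_the_inv_into[OF bij])
  have BA: "B (A f) = f" if "f \<in> carrier M" for f
    unfolding B_def using bij that by (auto simp: bij_betw_def the_inv_into_f_f)
  have "B \<in> iso (End_monoid ?G) M"
  proof (rule isoI)
    show "bij_betw B (carrier (End_monoid ?G)) (carrier M)" using B by (simp add: End_monoid_def)
    show "B \<in> hom (End_monoid ?G) M"
    proof (rule homI)
      fix \<phi> assume "\<phi> \<in> carrier (End_monoid ?G)"
      then show "B \<phi> \<in> carrier M" using B by (auto simp: End_monoid_def bij_betw_def)
    next
      fix \<phi> \<psi> assume "\<phi> \<in> carrier (End_monoid ?G)" "\<psi> \<in> carrier (End_monoid ?G)"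
      then obtain f h where "f \<in> carrier M" "h \<in> carrier M" "\<phi> = A f" "\<psi> = A h"
        using A_surj[of \<phi>] A_surj[of \<psi>] by (auto simp: End_monoid_def)
      then show "B (\<phi> \<otimes>\<^bsub>End_monoid ?G\<^esub> \<psi>) = B \<phi> \<otimes>\<^bsub>M\<^esub> B \<psi>"
        by (simp add: End_monoid_def A_mult BA)
    qed
  qed
  then show ?thesis by (auto simp: is_iso_def)
qed

text \<open>The vertices are renamed by an injection into the natural numbers. Their number is
  recorded in order to tell graphs of different size apart.\<close>

lemma nat_graph_exists:
  fixes M :: "('a, 'm) monoid_scheme" and E :: "('v \<times> 'v) set" and act :: "'a \<Rightarrow> 'v \<Rightarrow> 'v"
  assumes "monoid M" "finite V" "E \<subseteq> V \<times> V" "sym E" "irrefl E" "odd g"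
    and deg: "\<And>v. v \<in> V \<Longrightarrow> card (E `` {v}) = k"
    and girth: "\<And>n w. is_walk E n w \<Longrightarrow> w n = w 0 \<Longrightarrow> odd n \<Longrightarrow> g \<le> n"
    and c: "is_walk E g c" "c g = c 0" "inj_on c {..<g}"
    and act: "\<And>f v. f \<in> carrier M \<Longrightarrow> v \<in> V \<Longrightarrow> act f v \<in> V"
      "\<And>f u v. f \<in> carrier M \<Longrightarrow> (u, v) \<in> E \<Longrightarrow> (act f u, act f v) \<in> E"
      "\<And>f h v. f \<in> carrier M \<Longrightarrow> h \<in> carrier M \<Longrightarrow> v \<in> V \<Longrightarrow> act (f \<otimes>\<^bsub>M\<^esub> h) v = act f (act h v)"
    and inj: "\<And>f h. f \<in> carrier M \<Longrightarrow> h \<in> carrier M \<Longrightarrow> (\<And>v. v \<in> V \<Longrightarrow> act f v = act h v) \<Longrightarrow> f = h"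
    and surj: "\<And>\<phi>. \<phi> \<in> V \<rightarrow> V \<Longrightarrow> (\<And>u v. (u, v) \<in> E \<Longrightarrow> (\<phi> u, \<phi> v) \<in> E) \<Longrightarrow>
      \<exists>f\<in>carrier M. \<forall>v\<in>V. \<phi> v = act f v"
  shows "\<exists>G :: nat pair_pre_digraph. pair_graph G \<and> regular_graph G \<and> odd_girth G = enat g \<and>
    End_monoid G \<cong> M \<and> card (pverts G) = card V"
proof -
  obtain i :: "'v \<Rightarrow> nat" where i: "inj_on i V" using finite_imp_inj_to_nat_seg[OF assms(2)]
    by blast
  define j where "j = the_inv_into V i"
  define V' where "V' = i ` V"
  define E' where "E' = map_prod i i ` E"
  have j: "j (i v) = v" if "v \<in> V" for v using that i by (simp add: j_def the_inv_into_f_f)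
  have E'_iff: "(a, b) \<in> E' \<longleftrightarrow> (\<exists>u\<in>V. \<exists>v\<in>V. a = i u \<and> b = i v \<and> (u, v) \<in> E)" for a b
    using assms(3) by (force simp: E'_def)
  have fin': "finite V'" using assms(2) by (simp add: V'_def)
  have sub': "E' \<subseteq> V' \<times> V'" using assms(3) by (auto simp: E'_def V'_def)
  have sym': "sym E'" using assms(4) by (auto simp: sym_def E'_iff)
  have irr': "irrefl E'" using assms(5) i by (auto simp: irrefl_def E'_iff inj_on_def)
  have jE: "(j a, j b) \<in> E \<and> i (j a) = a \<and> i (j b) = b" if "(a, b) \<in> E'" for a b
    using that j by (auto simp: E'_iff)
  have iE: "(i u, i v) \<in> E'" if "(u, v) \<in> E" for u v using that by (auto simp: E'_def)
  have jw: "is_walk E n (j \<circ> w)" if "is_walk E' n w" for n w using that jE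
    by (auto simp: is_walk_def)
  let ?G = "\<lparr>pverts = V', parcs = E'\<rparr>"
  have "card (E' `` {a}) = k" if "a \<in> V'" for a
  proof -
    obtain v where v: "v \<in> V" "a = i v" using \<open>a \<in> V'\<close> by (auto simp: V'_def)
    have "E' `` {a} = i ` (E `` {v})"
    proof
      show "E' `` {a} \<subseteq> i ` (E `` {v})"
      proof
        fix b assume "b \<in> E' `` {a}"
        then have "(j a, j b) \<in> E" "i (j b) = b" using jE by auto
        then show "b \<in> i ` (E `` {v})" using v j by (intro image_eqI[of _ _ "j b"]) auto
      qed
      show "i ` (E `` {v}) \<subseteq> E' `` {a}" using v iE by auto
    qed
    moreover have "inj_on i (E `` {v})" using i assms(3) by (auto intro: inj_on_subset)
    ultimately show ?thesis using deg v by (simp add: card_image)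
  qed
  then have "regular_graph ?G" unfolding regular_graph_def by (auto simp: out_degree_pair)
  moreover have "pair_graph ?G" by (rule pair_graphI[OF fin' sub' sym' irr'])
  moreover have "odd_girth ?G = enat g"
  proof (rule odd_girth_eqI[OF fin' sub' \<open>odd g\<close>])
    show "g \<le> n" if "is_walk E' n w" "w n = w 0" "odd n" for n w
      using girth[OF jw[OF that(1)]] that by simp
    show "is_walk E' g (i \<circ> c)" using c(1) iE by (auto simp: is_walk_def)
    show "(i \<circ> c) g = (i \<circ> c) 0" using c(2) by simp
    have "c ` {..<g} \<subseteq> V" using c(1) assms(3) by (auto simp: is_walk_def)
    then show "inj_on (i \<circ> c) {..<g}" using c(3) i by (meson comp_inj_on inj_on_subset)
  qed
  moreover have "End_monoid ?G \<cong> M"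
  proof (rule End_monoid_iso[OF assms(1) sub', where act = "\<lambda>f. i \<circ> act f \<circ> j"])
    fix f v assume "f \<in> carrier M" "v \<in> V'"
    then show "(i \<circ> act f \<circ> j) v \<in> V'" using act(1) j by (auto simp: V'_def)
  next
    fix f u v assume "f \<in> carrier M" "(u, v) \<in> E'"
    then show "((i \<circ> act f \<circ> j) u, (i \<circ> act f \<circ> j) v) \<in> E'"
      using jE[of u v] act(2) iE by auto
  next
    fix f h v assume "f \<in> carrier M" "h \<in> carrier M" "v \<in> V'"
    then show "(i \<circ> act (f \<otimes>\<^bsub>M\<^esub> h) \<circ> j) v = (i \<circ> act f \<circ> j) ((i \<circ> act h \<circ> j) v)"
      using act(1,3) j by (auto simp: V'_def)
  next
    fix f h assume *: "f \<in> carrier M" "h \<in> carrier M" "\<And>v. v \<in> V' \<Longrightarrow> (i \<circ> act f \<circ> j) v = (i \<circ> act h \<circ> j) v"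
    have "act f v = act h v" if "v \<in> V" for v
      using *(3)[of "i v"] i act(1) * that j by (auto simp: V'_def inj_on_def)
    then show "f = h" using inj * by blast
  next
    fix \<phi> assume \<phi>: "\<phi> \<in> V' \<rightarrow> V'" "\<And>u v. (u, v) \<in> E' \<Longrightarrow> (\<phi> u, \<phi> v) \<in> E'"
    have "j \<circ> \<phi> \<circ> i \<in> V \<rightarrow> V" using \<phi>(1) j
      by (auto simp: V'_def Pi_iff)
    moreover have "((j \<circ> \<phi> \<circ> i) u, (j \<circ> \<phi> \<circ> i) v) \<in> E"
      if "(u, v) \<in> E" for u v
      using jE[OF \<phi>(2)[OF iE[OF that]]] by simp
    ultimately obtain f where f: "f \<in> carrier M" "\<forall>v\<in>V. (j \<circ> \<phi> \<circ> i) v = act f v" using surj by blast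
    have "\<phi> a = (i \<circ> act f \<circ> j) a" if "a \<in> V'" for a
    proof -
      obtain v where v: "v \<in> V" "a = i v" using \<open>a \<in> V'\<close> by (auto simp: V'_def)
      obtain w where w: "w \<in> V" "\<phi> a = i w" using \<phi>(1) \<open>a \<in> V'\<close>
        by (auto simp: V'_def Pi_iff)
      have "w = act f v" using f(2) v w j by fastforce
      then show ?thesis using v w j by simp
    qed
    then show "\<exists>f\<in>carrier M. \<forall>v\<in>V'. \<phi> v = (i \<circ> act f \<circ> j) v"
      using f(1) by blast
  qed
  moreover have "card V' = card V" using i by (simp add: V'_def card_image)
  ultimately show ?thesis by (intro exI[of _ ?G]) simp
qed

section \<open>The regular graph of a monoid\<close>

lemma card_residue_class: "r < 5 \<Longrightarrow> card {l. l < 5 * k \<and> l mod 5 = r} = k"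
proof -
  assume r: "r < (5::nat)"
  have "{l. l < 5 * k \<and> l mod 5 = r} = (\<lambda>i. 5 * i + r) ` {..<k}"
  proof
    show "{l. l < 5 * k \<and> l mod 5 = r} \<subseteq> (\<lambda>i. 5 * i + r) ` {..<k}"
    proof
      fix l assume "l \<in> {l. l < 5 * k \<and> l mod 5 = r}"
      then have "l = 5 * (l div 5) + r" "l div 5 < k" by auto
      then show "l \<in> (\<lambda>i. 5 * i + r) ` {..<k}" by blast
    qed
  qed (use r in auto)
  then show ?thesis by (simp add: card_image inj_on_def)
qed

lemma mod5_cancel:
  assumes "(l + i) mod 5 = (l + j) mod (5 :: nat)"
  shows "i mod 5 = j mod 5"
proof -
  \<comment> \<open>Adding \<open>4 * l\<close> turns the common summand into a multiple of 5, which
    avoids subtraction.\<close>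
  have "(4 * l + (l + i)) mod 5 = (4 * l + (l + j)) mod 5" using refl assms by (rule mod_add_cong)
  moreover have "4 * l + (l + i) = 5 * l + i" "4 * l + (l + j) = 5 * l + j" by simp_all
  ultimately show ?thesis by (simp only: mod_mult_self4)
qed

section \<open>Cells and the graph built on them\<close>

text \<open>\<open>d\<close> gives every monoid element its own label parameter, so that the third
  coordinate of a cell can be recovered from \<open>twist\<close>. The free number \<open>u\<close>
  controls the size of the graph.\<close>

locale monoid_cells = monoid M for M (structure) +
  fixes e u :: nat and d :: "'a \<Rightarrow> nat"
  assumes finite_carrier: "finite (carrier M)" and even_e: "even e"
    and inj_d: "inj_on d (carrier M)" and d_ge: "m \<in> carrier M \<Longrightarrow> 3 \<le> d m"
    and d_le: "m \<in> carrier M \<Longrightarrow> m' \<in> carrier M \<Longrightarrow> 5 * d m + 5 * d m' + 10 < 5 * u"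
begin

definition q :: nat where "q = 5 * u"

definition cells :: "('a \<times> 'a \<times> 'a \<times> nat) set" where
  "cells = carrier M \<times> carrier M \<times> carrier M \<times> {..<3 * q}"

definition step :: "'a \<times> 'a \<times> 'a \<times> nat \<Rightarrow> 'a \<times> 'a \<times> 'a \<times> nat" where
  "step = (\<lambda>(x, y, m, l). (x, y, m, next_label q (y = x \<otimes> m) l))"

definition twist :: "'a \<times> 'a \<times> 'a \<times> nat \<Rightarrow> 'a \<times> 'a \<times> 'a \<times> nat" where
  "twist = (\<lambda>(x, y, m, l). (x, y, m, twist_label q (d m) (y = x \<otimes> m) l))"

text \<open>Labels enter only through their residues, with increment 2. The converse relation has
  increment 3, and both differ from the increments 0 and 1 of the identity, \<open>twist\<close> and
  \<open>step\<close>.\<close>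

definition link :: "'a \<times> 'a \<times> 'a \<times> nat \<Rightarrow> 'a \<times> 'a \<times> 'a \<times> nat \<Rightarrow> bool" where
  "link = (\<lambda>(x, y, m, l) (x', y', m', l'). x' = y \<and> l' mod 5 = (l + 2) mod 5)"

text \<open>
  As \<open>link\<close> is asymmetric, a permutation \<open>p\<close> is recovered as the intersection of the two relations
  \<open>link \<union> p\<close> and \<open>link\<inverse> \<union> p\<close>. The permutation makes up for the smaller degree of the vertices of the
  wheel outside \<open>{0, 1, e + 5, 2 * e + 8}\<close>.
\<close>

definition soft :: "nat \<Rightarrow> 'a \<times> 'a \<times> 'a \<times> nat \<Rightarrow> 'a \<times> 'a \<times> 'a \<times> nat \<Rightarrow> bool" where
  "soft v a b =
     (if v \<in> {0, 1, e + 5, 2 * e + 8} then link a b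
      else if v = 2 then link a b \<or> b = step a
      else if v = 3 then link b a \<or> b = step a
      else if v = 4 then link a b \<or> b = twist a
      else if v = e + 6 then link b a \<or> b = twist a
      else if v = e + 7 then link b a \<or> b = a
      else link a b \<or> b = a)"

definition gverts :: "(nat \<times> ('a \<times> 'a \<times> 'a \<times> nat) \<times> bool) set" where
  "gverts = {..<3 * e + 13} \<times> cells \<times> UNIV"

text \<open>\<open>soft v\<close> is read from the cell on side \<open>False\<close> to the cell on
  side \<open>True\<close>, which makes the edges symmetric although \<open>soft v\<close> is
  not.\<close>

definition gedges :: "((nat \<times> ('a \<times> 'a \<times> 'a \<times> nat) \<times> bool) \<times> (nat \<times> ('a \<times> 'a \<times> 'a \<times> nat) \<times> bool)) set" where
  "gedges = {((v, a, s), (v', a', s')). (v, a, s) \<in> gverts \<and> (v', a', s') \<in> gverts \<and>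
     ((v, v') \<in> wheel e \<and> a = a' \<and> s = s' \<or>
      v = v' \<and> (if s then \<not> s' \<and> soft v a' a else s' \<and> soft v a a'))}"

section \<open>Degrees\<close>

lemma d_less: "m \<in> carrier M \<Longrightarrow> 5 * d m < q"
  using d_le[of m m] by (simp add: q_def)

lemma step_cells: "a \<in> cells \<Longrightarrow> step a \<in> cells"
  by (auto simp: cells_def step_def next_label_range)

lemma twist_cells: "a \<in> cells \<Longrightarrow> twist a \<in> cells"
  by (auto simp: cells_def twist_def twist_label_range_mod5(1)[OF d_ge d_less q_def])

lemma inj_step: "inj_on step cells"
  by (auto simp: inj_on_def cells_def step_def dest: next_label_inj)

lemma inj_twist: "inj_on twist cells"
  by (auto simp: inj_on_def cells_def twist_def dest: twist_label_inj[OF d_ge d_less])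

lemma finite_cells: "finite cells"
  using finite_carrier by (simp add: cells_def)

lemma finite_gverts: "finite gverts"
  using finite_cells by (simp add: gverts_def)

lemma card_gverts: "card gverts = (3 * e + 13) * (card (carrier M) ^ 3 * (15 * u)) * 2"
  by (simp add: gverts_def cells_def card_cartesian_product power3_eq_cube UNIV_bool q_def)

definition base_degree :: nat where
  "base_degree = card (carrier M) * card (carrier M) * (3 * u)"

text \<open>Two coordinates of the partner are free, and one residue class contains
  \<open>3 * u\<close> of the \<open>15 * u\<close> labels.\<close>

lemma card_link:
  assumes "a \<in> cells"
  shows "card {b \<in> cells. link a b} = base_degree" "card {b \<in> cells. link b a} = base_degree"
proof -
  obtain x y m l where a: "a = (x, y, m, l)" by (cases a)
  have "{b \<in> cells. link a b} = {y} \<times> carrier M \<times> carrier M \<times> {l'. l' < 5 * (3 * u) \<and> l' mod 5 = (l + 2) mod 5}"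
    using assms by (auto simp: a cells_def link_def q_def)
  then show "card {b \<in> cells. link a b} = base_degree"
    using card_residue_class[of "(l + 2) mod 5" "3 * u"]
      by (simp add: card_cartesian_product base_degree_def)
  have eq: "l mod 5 = (l' + 2) mod 5 \<longleftrightarrow> l' mod 5 = (l + 3) mod 5" for l'
  proof
    assume "l mod 5 = (l' + 2) mod 5"
    then have "(l' + 2) mod 5 = l mod 5" ..
    then have "(l' + 2 + 3) mod 5 = (l + 3) mod 5" by (rule mod_add_cong) simp
    then show "l' mod 5 = (l + 3) mod 5" by (simp add: add.assoc)
  next
    assume "l' mod 5 = (l + 3) mod 5"
    then have "(l' + 2) mod 5 = (l + 3 + 2) mod 5" by (rule mod_add_cong) simp
    then show "l mod 5 = (l' + 2) mod 5" by (simp add: add.assoc)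
  qed
  have "{b \<in> cells. link b a} = carrier M \<times> {x} \<times> carrier M \<times> {l'. l' < 5 * (3 * u) \<and> l' mod 5 = (l + 3) mod 5}"
    using assms by (auto simp: a cells_def link_def q_def eq simp del: add_2_eq_Suc')
  then show "card {b \<in> cells. link b a} = base_degree"
    using card_residue_class[of "(l + 3) mod 5" "3 * u"]
      by (simp add: card_cartesian_product base_degree_def)
qed

definition label_of :: "'a \<times> 'a \<times> 'a \<times> nat \<Rightarrow> nat" where "label_of = (\<lambda>(x, y, m, l). l)"

lemma link_label_of: "link a b \<Longrightarrow> label_of b mod 5 = (label_of a + 2) mod 5"
  by (auto simp: link_def label_of_def)

lemma step_label_of: "a \<in> cells \<Longrightarrow> label_of (step a) mod 5 = (label_of a + 1) mod 5"
  by (auto simp: step_def label_of_def cells_def next_label_mod5[OF q_def])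

lemma twist_label_of: "a \<in> cells \<Longrightarrow> label_of (twist a) mod 5 = label_of a mod 5"
  by (auto simp: twist_def label_of_def cells_def twist_label_range_mod5(2)[OF d_ge d_less q_def])

lemma not_link:
  assumes "label_of b mod 5 = (label_of a + k) mod 5" "k = 0 \<or> k = 1"
  shows "\<not> link a b" "\<not> link b a"
proof -
  have *: False if h: "(l' :: nat) mod 5 = (l + k) mod 5"
    and "l' mod 5 = (l + 2) mod 5 \<or> l mod 5 = (l' + 2) mod 5" for l l'
    using that(2)
  proof
    assume "l' mod 5 = (l + 2) mod 5"
    then have "(l + k) mod 5 = (l + 2) mod 5" using h by simp
    from mod5_cancel[OF this] show False using assms(2) by auto
  next
    assume "l mod 5 = (l' + 2) mod 5"
    also have "\<dots> = (l + k + 2) mod 5" using h by (rule mod_add_cong) simp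
    finally have "(l + 0) mod 5 = (l + (k + 2)) mod 5" by (simp add: add.assoc)
    from mod5_cancel[OF this] have "0 mod 5 = (k + 2) mod 5" .
    moreover have "k + 2 = 2 \<or> k + 2 = 3" using assms(2) by auto
    ultimately show False by (elim disjE) simp_all
  qed
  show "\<not> link a b" "\<not> link b a"
    using *[OF assms(1)] link_label_of by blast+
qed

lemma link_asym: "\<not> (link a b \<and> link b a)"
proof
  assume "link a b \<and> link b a"
  then have h: "label_of b mod 5 = (label_of a + 2) mod 5"
    and "label_of a mod 5 = (label_of b + 2) mod 5" using link_label_of by auto
  note this(2)
  also have "(label_of b + 2) mod 5 = (label_of a + 2 + 2) mod 5" using h by (rule mod_add_cong) simp
  finally have "(label_of a + 0) mod 5 = (label_of a + 4) mod 5" by (simp add: ac_simps)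
  from mod5_cancel[OF this] show False by simp
qed

text \<open>Residues keep \<open>p a\<close> out of both link neighbourhoods, so it adds exactly one
  neighbour. On a finite set the injective \<open>p\<close> is also onto, which gives the same count
  from the other side.\<close>

lemma card_link_fun:
  assumes p: "\<And>a. a \<in> cells \<Longrightarrow> p a \<in> cells" "inj_on p cells"
    and k: "\<And>a. a \<in> cells \<Longrightarrow> label_of (p a) mod 5 = (label_of a + k) mod 5" "k = 0 \<or> k = 1"
    and a: "a \<in> cells"
  shows "card {b \<in> cells. link a b \<or> b = p a} = base_degree + 1"
    "card {b \<in> cells. link b a \<or> b = p a} = base_degree + 1"
    "card {b \<in> cells. link b a \<or> a = p b} = base_degree + 1"
    "card {b \<in> cells. link a b \<or> a = p b} = base_degree + 1"
proof -
  have fin: "finite {b \<in> cells. P b}" for P using finite_cells by simp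
  have n: "\<not> link b (p b)" "\<not> link (p b) b" if "b \<in> cells" for b
    using not_link[OF k(1)[OF that] k(2)] by auto
  have "{b \<in> cells. link a b \<or> b = p a} = insert (p a) {b \<in> cells. link a b}"
    "{b \<in> cells. link b a \<or> b = p a} = insert (p a) {b \<in> cells. link b a}"
    using p(1)[OF a] by blast+
  then show "card {b \<in> cells. link a b \<or> b = p a} = base_degree + 1"
    "card {b \<in> cells. link b a \<or> b = p a} = base_degree + 1"
    using n[OF a] card_link[OF a] fin by (simp_all add: card_insert_disjoint)
  have "p ` cells = cells" using p finite_cells by (meson endo_inj_surj image_subsetI)
  then obtain c where c: "c \<in> cells" "a = p c" using a by blast
  then have "{b \<in> cells. link b a \<or> a = p b} = insert c {b \<in> cells. link b a}"
    "{b \<in> cells. link a b \<or> a = p b} = insert c {b \<in> cells. link a b}"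
    using p(2) c by (blast dest: inj_onD)+
  then show "card {b \<in> cells. link b a \<or> a = p b} = base_degree + 1"
    "card {b \<in> cells. link a b \<or> a = p b} = base_degree + 1"
    using n[OF c(1)] c card_link[OF a] fin by (simp_all add: card_insert_disjoint)
qed

lemma soft_cases:
  assumes "v \<notin> {0, 1, e + 5, 2 * e + 8}"
  obtains "soft v = (\<lambda>a b. link a b \<or> b = step a)" | "soft v = (\<lambda>a b. link b a \<or> b = step a)"
  | "soft v = (\<lambda>a b. link a b \<or> b = twist a)" | "soft v = (\<lambda>a b. link b a \<or> b = twist a)"
  | "soft v = (\<lambda>a b. link a b \<or> b = a)" | "soft v = (\<lambda>a b. link b a \<or> b = a)"
proof -
  have v: "(v \<in> {0, 1, e + 5, 2 * e + 8}) = False" using assms by simp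
  consider "v = 2" | "v \<noteq> 2" "v = 3" | "v \<noteq> 2" "v \<noteq> 3" "v = 4" | "v \<noteq> 2" "v \<noteq> 3" "v \<noteq> 4" "v = e + 6"
    | "v \<noteq> 2" "v \<noteq> 3" "v \<noteq> 4" "v \<noteq> e + 6" "v = e + 7"
    | "v \<noteq> 2" "v \<noteq> 3" "v \<noteq> 4" "v \<noteq> e + 6" "v \<noteq> e + 7" by argo
  then show thesis
  proof cases
    case 1
    have "soft v = (\<lambda>a b. link a b \<or> b = step a)" unfolding soft_def v if_False using 1
      by simp
    then show ?thesis by (rule that(1))
  next
    case 2
    have "soft v = (\<lambda>a b. link b a \<or> b = step a)" unfolding soft_def v if_False using 2
      by simp
    then show ?thesis by (rule that(2))
  next
    case 3
    have "soft v = (\<lambda>a b. link a b \<or> b = twist a)" unfolding soft_def v if_False using 3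
      by simp
    then show ?thesis by (rule that(3))
  next
    case 4
    have "soft v = (\<lambda>a b. link b a \<or> b = twist a)" unfolding soft_def v if_False using 4
      by simp
    then show ?thesis by (rule that(4))
  next
    case 5
    have "soft v = (\<lambda>a b. link b a \<or> b = a)" unfolding soft_def v if_False using 5 by simp
    then show ?thesis by (rule that(6))
  next
    case 6
    have "soft v = (\<lambda>a b. link a b \<or> b = a)" unfolding soft_def v if_False using 6 by simp
    then show ?thesis by (rule that(5))
  qed
qed

lemma card_soft:
  assumes "a \<in> cells"
  shows "card {b \<in> cells. soft v a b} = (if v \<in> {0, 1, e + 5, 2 * e + 8} then base_degree else base_degree + 1)" (is ?A)
    "card {b \<in> cells. soft v b a} = (if v \<in> {0, 1, e + 5, 2 * e + 8} then base_degree else base_degree + 1)" (is ?B)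
proof -
  have I: "card {b \<in> cells. link a b \<or> b = a} = base_degree + 1"
    "card {b \<in> cells. link b a \<or> b = a} = base_degree + 1"
    "card {b \<in> cells. link b a \<or> a = b} = base_degree + 1"
    "card {b \<in> cells. link a b \<or> a = b} = base_degree + 1"
    using card_link_fun[of "\<lambda>a. a" 0 a] assms by simp_all
  have S: "card {b \<in> cells. link a b \<or> b = step a} = base_degree + 1"
    "card {b \<in> cells. link b a \<or> b = step a} = base_degree + 1"
    "card {b \<in> cells. link b a \<or> a = step b} = base_degree + 1"
    "card {b \<in> cells. link a b \<or> a = step b} = base_degree + 1"
    using card_link_fun[of step 1 a] step_cells inj_step step_label_of assms by simp_all
  have T: "card {b \<in> cells. link a b \<or> b = twist a} = base_degree + 1"
    "card {b \<in> cells. link b a \<or> b = twist a} = base_degree + 1"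
    "card {b \<in> cells. link b a \<or> a = twist b} = base_degree + 1"
    "card {b \<in> cells. link a b \<or> a = twist b} = base_degree + 1"
    using card_link_fun[of twist 0 a] twist_cells inj_twist twist_label_of assms by simp_all
  have "?A \<and> ?B"
  proof (cases "v \<in> {0, 1, e + 5, 2 * e + 8}")
    case True
    have v: "(v \<in> {0, 1, e + 5, 2 * e + 8}) = True" using True by simp
    have "soft v = link" unfolding soft_def v if_True ..
    then show ?thesis by (simp only: v if_True card_link[OF assms])
  next
    case False
    have v: "(v \<in> {0, 1, e + 5, 2 * e + 8}) = False" using False by simp
    show ?thesis
      by (rule soft_cases[OF False]; simp only: I S T v if_False)
  qed
  then show ?A ?B by blast+
qed

lemma gedges_sub: "gedges \<subseteq> gverts \<times> gverts"
  by (auto simp: gedges_def)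

lemma sym_gedges: "sym gedges"
  by (auto simp: sym_def gedges_def dest: wheel_sym split: if_splits)

lemma irrefl_gedges: "irrefl gedges"
  by (auto simp: irrefl_def gedges_def wheel_irrefl split: if_splits)

text \<open>The extra soft neighbour of a wheel vertex of degree two compensates for its missing
  wheel neighbour.\<close>

lemma gedges_degree:
  assumes "x \<in> gverts"
  shows "card (gedges `` {x}) = base_degree + 3"
proof -
  obtain v a s where x: "x = (v, a, s)" by (cases x)
  have v: "v < 3 * e + 13" "a \<in> cells" using assms by (auto simp: x gverts_def)
  define S where "S = {b \<in> cells. if s then soft v b a else soft v a b}"
  have eq: "gedges `` {x} = (\<lambda>v'. (v', a, s)) ` (wheel e `` {v}) \<union> (\<lambda>b. (v, b, \<not> s)) ` S"
  proof
    show "gedges `` {x} \<subseteq> (\<lambda>v'. (v', a, s)) ` (wheel e `` {v}) \<union> (\<lambda>b. (v, b, \<not> s)) ` S"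
      by (auto simp: gedges_def x S_def gverts_def split: if_splits)
    show "(\<lambda>v'. (v', a, s)) ` (wheel e `` {v}) \<union> (\<lambda>b. (v, b, \<not> s)) ` S \<subseteq> gedges `` {x}"
      using v wheel_bound[of v _ e] by (auto simp: gedges_def x S_def gverts_def)
  qed
  have fin: "finite (wheel e `` {v})"
    by (rule finite_subset[of _ "{..<3 * e + 13}"]) (auto dest: wheel_bound)
  have "card (gedges `` {x}) = card (wheel e `` {v}) + card S"
    unfolding eq
    by (subst card_Un_disjoint) (auto simp: card_image inj_on_def fin S_def finite_cells)
  also have "card S = (if v \<in> {0, 1, e + 5, 2 * e + 8} then base_degree else base_degree + 1)"
    using card_soft[OF v(2), of v] by (cases s) (simp_all only: S_def if_True if_False)
  finally show ?thesis using wheel_degree[OF v(1)]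
    by (cases "v \<in> {0, 1, e + 5, 2 * e + 8}") (simp_all only: if_True if_False)
qed

section \<open>Odd girth of the graph\<close>

text \<open>Soft steps are dropped, and \<open>k\<close> counts the others. Each soft step changes
  the side, so the parity of \<open>n - k\<close>, written as that of \<open>n + k\<close>, tells
  whether the side has changed.\<close>

lemma project_walk:
  assumes "is_walk gedges n w"
  shows "\<exists>k w'. k \<le> n \<and> is_walk (wheel e) k w' \<and> w' 0 = fst (w 0) \<and> w' k = fst (w n) \<and>
    (even (n + k) \<longleftrightarrow> snd (snd (w n)) = snd (snd (w 0))) \<and> (k = n \<longrightarrow> (\<forall>i\<le>n. snd (w i) = snd (w 0)))"
  using assms
proof (induction n)
  case 0
  then show ?case by (intro exI[of _ 0] exI[of _ "fst \<circ> w"]) (auto simp: is_walk_def)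
next
  case (Suc n)
  then have "is_walk gedges n w" by (auto simp: is_walk_def)
  from Suc.IH[OF this] obtain k w' where k: "k \<le> n" "is_walk (wheel e) k w'" "w' 0 = fst (w 0)" "w' k = fst (w n)"
    "even (n + k) \<longleftrightarrow> snd (snd (w n)) = snd (snd (w 0))" "k = n \<longrightarrow> (\<forall>i\<le>n. snd (w i) = snd (w 0))" by blast
  have "(w n, w (Suc n)) \<in> gedges" using Suc.prems by (auto simp: is_walk_def)
  then have "(fst (w n), fst (w (Suc n))) \<in> wheel e \<and> snd (w n) = snd (w (Suc n)) \<or>
    fst (w n) = fst (w (Suc n)) \<and> snd (snd (w (Suc n))) \<noteq> snd (snd (w n))"
    by (cases "w n"; cases "w (Suc n)") (auto simp: gedges_def split: if_splits)
  then consider "(fst (w n), fst (w (Suc n))) \<in> wheel e" "snd (w n) = snd (w (Suc n))"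
    | "fst (w n) = fst (w (Suc n))" "snd (snd (w (Suc n))) \<noteq> snd (snd (w n))" by blast
  then show ?case
  proof cases
    case 1
    define w2 where "w2 i = (if i = Suc k then fst (w (Suc n)) else w' i)" for i
    have "is_walk (wheel e) (Suc k) w2" using k(2,4) 1(1) by (auto simp: is_walk_def w2_def less_Suc_eq)
    moreover have "w2 0 = fst (w 0)" "w2 (Suc k) = fst (w (Suc n))" using k(3) by (auto simp: w2_def)
    moreover have "even (Suc n + Suc k) \<longleftrightarrow> snd (snd (w (Suc n))) = snd (snd (w 0))"
      using k(5) 1(2) by simp
    moreover have "Suc k = Suc n \<longrightarrow> (\<forall>i\<le>Suc n. snd (w i) = snd (w 0))"
    proof (intro impI allI)
      fix i assume i: "Suc k = Suc n" "i \<le> Suc n"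
      then have all: "\<forall>i\<le>n. snd (w i) = snd (w 0)" using k(6) by blast
      show "snd (w i) = snd (w 0)"
      proof (cases "i = Suc n")
        case True
        then show ?thesis using all 1(2) by (metis le_refl)
      next
        case False
        then have "i \<le> n" using i(2) by simp
        then show ?thesis using all by blast
      qed
    qed
    moreover have "Suc k \<le> Suc n" using k(1) by simp
    ultimately show ?thesis by blast
  next
    case 2
    have "k \<le> Suc n" "k = Suc n \<longrightarrow> (\<forall>i\<le>Suc n. snd (w i) = snd (w 0))"
      using k(1) by simp_all
    moreover have "w' k = fst (w (Suc n))" using k(4) 2(1) by simp
    moreover have "even (Suc n + k) \<longleftrightarrow> snd (snd (w (Suc n))) = snd (snd (w 0))"
      using k(5) 2(2) by auto
    ultimately show ?thesis using k(2,3) by blast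
  qed
qed

lemma gedges_odd_closed_walk:
  assumes "is_walk gedges n w" "w n = w 0" "odd n"
  shows "e + 7 \<le> n" "n = e + 7 \<Longrightarrow> i \<le> n \<Longrightarrow> snd (w i) = snd (w 0)"
proof -
  obtain k w' where k: "k \<le> n" "is_walk (wheel e) k w'" "w' 0 = fst (w 0)" "w' k = fst (w n)"
    "even (n + k) \<longleftrightarrow> snd (snd (w n)) = snd (snd (w 0))" "k = n \<longrightarrow> (\<forall>i\<le>n. snd (w i) = snd (w 0))"
    using project_walk[OF assms(1)] by blast
  have "odd k" using k(5) assms(2,3) by simp
  then have "e + 7 \<le> k" using wheel_odd_closed_walk[OF even_e k(2)] k(3,4) assms(2) by simp
  then show "e + 7 \<le> n" using k(1) by simp
  show "snd (w i) = snd (w 0)" if "n = e + 7" "i \<le> n"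
  proof -
    have "k = n" using k(1) \<open>e + 7 \<le> k\<close> that(1) by linarith
    then show ?thesis using k(6) that(2) by blast
  qed
qed

section \<open>The monoid acting by left translations\<close>

text \<open>A mark \<open>y = x \<otimes> m\<close> survives left translation, but a new one may
  appear; then the label is folded.\<close>

definition shift :: "'a \<Rightarrow> 'a \<times> 'a \<times> 'a \<times> nat \<Rightarrow> 'a \<times> 'a \<times> 'a \<times> nat" where
  "shift f = (\<lambda>(x, y, m, l). (f \<otimes> x, f \<otimes> y, m, fold_label q (y = x \<otimes> m) (f \<otimes> y = f \<otimes> x \<otimes> m) l))"

definition act :: "'a \<Rightarrow> nat \<times> ('a \<times> 'a \<times> 'a \<times> nat) \<times> bool \<Rightarrow> nat \<times> ('a \<times> 'a \<times> 'a \<times> nat) \<times> bool" where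
  "act f = (\<lambda>(v, a, s). (v, shift f a, s))"

lemma fold_label_less: "l < 3 * q \<Longrightarrow> fold_label q \<mu> \<mu>' l < 3 * q"
  by (auto simp: fold_label_def intro: le_less_trans[OF mod_less_eq_dividend])

lemma fold_label_mod5: "fold_label q \<mu> \<mu>' l mod 5 = l mod 5"
  by (simp add: fold_label_def q_def mod_mod_cancel)

lemma mark_mono: "f \<in> carrier M \<Longrightarrow> x \<in> carrier M \<Longrightarrow> m \<in> carrier M \<Longrightarrow> f \<otimes> (x \<otimes> m) = f \<otimes> x \<otimes> m"
  by (simp add: m_assoc)

lemma shift_cells: "f \<in> carrier M \<Longrightarrow> a \<in> cells \<Longrightarrow> shift f a \<in> cells"
  by (auto simp: shift_def cells_def fold_label_less)

lemma shift_step: "f \<in> carrier M \<Longrightarrow> a \<in> cells \<Longrightarrow> shift f (step a) = step (shift f a)"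
  by (auto simp: shift_def step_def cells_def mark_mono next_label_fold_label)

lemma shift_twist: "f \<in> carrier M \<Longrightarrow> a \<in> cells \<Longrightarrow> shift f (twist a) = twist (shift f a)"
  by (auto simp: shift_def twist_def cells_def mark_mono twist_label_fold_label[OF d_ge d_less])

lemma shift_link: "link a b \<Longrightarrow> link (shift f a) (shift f b)"
proof -
  obtain x y m l x' y' m' l' where ab: "a = (x, y, m, l)" "b = (x', y', m', l')" by (cases a; cases b)
  assume "link a b"
  then have h: "x' = y" "l' mod 5 = (l + 2) mod 5" by (simp_all add: ab link_def)
  have "(l + 2) mod 5 = (fold_label q (y = x \<otimes> m) (f \<otimes> y = f \<otimes> x \<otimes> m) l + 2) mod 5"
    by (rule mod_add_cong) (simp_all add: fold_label_mod5)
  then show ?thesis using h by (simp add: ab link_def shift_def fold_label_mod5 del: add_2_eq_Suc')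
qed

lemma shift_soft:
  assumes "f \<in> carrier M" "a \<in> cells" "b \<in> cells" "soft v a b"
  shows "soft v (shift f a) (shift f b)"
proof (cases "v \<in> {0, 1, e + 5, 2 * e + 8}")
  case True
  have v: "(v \<in> {0, 1, e + 5, 2 * e + 8}) = True" using True by simp
  have "soft v = link" unfolding soft_def v if_True ..
  then show ?thesis using assms shift_link by metis
next
  case False
  have *: "soft v (shift f a) (shift f b)" if "soft v = (\<lambda>a b. L a b \<or> b = p a)"
    "\<And>a b. L a b \<Longrightarrow> L (shift f a) (shift f b)" "\<And>a. a \<in> cells \<Longrightarrow> shift f (p a) = p (shift f a)" for L p
  proof -
    have "L a b \<or> b = p a" using assms(4) unfolding that(1) .
    then have "L (shift f a) (shift f b) \<or> shift f b = p (shift f a)"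
      using that(2)[of a b] that(3)[OF assms(2)] by (elim disjE) simp_all
    then show ?thesis unfolding that(1) .
  qed
  note S = shift_step[OF assms(1)] and T = shift_twist[OF assms(1)]
  show ?thesis
  proof (rule soft_cases[OF False])
    assume "soft v = (\<lambda>a b. link a b \<or> b = step a)" then show ?thesis
      by (rule *) (use shift_link S in auto)
  next
    assume "soft v = (\<lambda>a b. link b a \<or> b = step a)" then show ?thesis
      by (rule *) (use shift_link S in auto)
  next
    assume "soft v = (\<lambda>a b. link a b \<or> b = twist a)" then show ?thesis
      by (rule *) (use shift_link T in auto)
  next
    assume "soft v = (\<lambda>a b. link b a \<or> b = twist a)" then show ?thesis
      by (rule *) (use shift_link T in auto)
  next
    assume "soft v = (\<lambda>a b. link a b \<or> b = a)" then show ?thesis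
      by (rule *) (use shift_link in auto)
  next
    assume "soft v = (\<lambda>a b. link b a \<or> b = a)" then show ?thesis
      by (rule *) (use shift_link in auto)
  qed
qed

lemma act_verts: "f \<in> carrier M \<Longrightarrow> x \<in> gverts \<Longrightarrow> act f x \<in> gverts"
  by (auto simp: act_def gverts_def shift_cells)

lemma act_edges:
  assumes "f \<in> carrier M" "(x, y) \<in> gedges"
  shows "(act f x, act f y) \<in> gedges"
proof -
  obtain v a s v' a' s' where xy: "x = (v, a, s)" "y = (v', a', s')" by (cases x; cases y)
  have c: "a \<in> cells" "a' \<in> cells" "v < 3 * e + 13" "v' < 3 * e + 13"
    using assms(2) by (auto simp: xy gedges_def gverts_def)
  show ?thesis
    using assms c shift_soft[OF assms(1) c(1,2)] shift_soft[OF assms(1) c(2,1)] shift_cells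
    by (auto simp: xy gedges_def gverts_def act_def split: if_splits)
qed

text \<open>As marks are never lost, at most one of the two translations folds the label, and one
  does exactly when the product does.\<close>

lemma act_mult:
  assumes "f \<in> carrier M" "h \<in> carrier M" "x \<in> gverts"
  shows "act (f \<otimes> h) x = act f (act h x)"
proof -
  obtain v x' y m l s where x: "x = (v, (x', y, m, l), s)" by (cases x) auto
  have c: "x' \<in> carrier M" "y \<in> carrier M" "m \<in> carrier M" using assms(3)
    by (auto simp: x gverts_def cells_def)
  have "y = x' \<otimes> m \<Longrightarrow> h \<otimes> y = h \<otimes> x' \<otimes> m" "h \<otimes> y = h \<otimes> x' \<otimes> m \<Longrightarrow> f \<otimes> (h \<otimes> y) = f \<otimes> (h \<otimes> x') \<otimes> m"
    using c assms by (simp_all add: m_assoc)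
  then show ?thesis using c assms by (auto simp: x act_def shift_def m_assoc fold_label_def)
qed

lemma q_gt: "10 < q"
  using d_le[OF one_closed one_closed] by (simp add: q_def)

lemma act_inj:
  assumes "f \<in> carrier M" "h \<in> carrier M" "\<And>x. x \<in> gverts \<Longrightarrow> act f x = act h x"
  shows "f = h"
proof -
  have "(0, (\<one>, \<one>, \<one>, 0), False) \<in> gverts" using q_gt
    by (simp add: gverts_def cells_def)
  from assms(3)[OF this] show ?thesis using assms(1,2) by (simp add: act_def shift_def)
qed

lemma girth_cycle_exists:
  defines "c \<equiv> \<lambda>i. (face e 0 i, (\<one>, \<one>, \<one>, 0 :: nat), False)"
  shows "is_walk gedges (e + 7) c" "c (e + 7) = c 0" "inj_on c {..<e + 7}"
proof -
  have a: "(\<one>, \<one>, \<one>, 0) \<in> cells" using q_gt by (simp add: cells_def)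
  show "is_walk gedges (e + 7) c"
    using face_walk[of 0 _ e] wheel_bound a by (auto simp: is_walk_def c_def gedges_def gverts_def)
  show "c (e + 7) = c 0" by (simp add: c_def face_def)
  show "inj_on c {..<e + 7}" by (auto simp: inj_on_def c_def face_def split: if_splits)
qed

section \<open>Endomorphisms are left translations\<close>

text \<open>The faces of a copy go to closed walks of length \<open>e + 7\<close>, each inside one
  copy. They share the hub, so the whole copy goes into one copy, and \<open>wheel_rigid\<close>
  applies.\<close>

lemma endo_fixes_wheel:
  assumes "\<phi> \<in> gverts \<rightarrow> gverts" and hom: "\<And>x y. (x, y) \<in> gedges \<Longrightarrow> (\<phi> x, \<phi> y) \<in> gedges"
  shows "\<exists>\<sigma>. \<forall>v<3 * e + 13. \<forall>a\<in>cells. \<forall>s. \<phi> (v, a, s) = (v, \<sigma> (a, s))"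
proof (intro exI[of _ "\<lambda>p. snd (\<phi> (0, p))"] allI impI ballI)
  fix v a s assume v: "v < 3 * e + 13" and a: "a \<in> cells"
  have hard: "((v1, a, s), (v2, a, s)) \<in> gedges" if "(v1, v2) \<in> wheel e" for v1 v2
    using that a wheel_bound[OF that] by (auto simp: gedges_def gverts_def)
  have piece: "snd (\<phi> (v, a, s)) = snd (\<phi> (0, a, s))" if "v < 3 * e + 13" for v
  proof -
    obtain j i where ji: "j < 3" "i < e + 7" "v = face e j i"
      using face_surj[OF \<open>v < 3 * e + 13\<close>] by blast
    define w where "w i = \<phi> (face e j i, a, s)" for i
    have "is_walk gedges (e + 7) w"
      using hom hard face_walk[OF ji(1)] by (auto simp: is_walk_def w_def)
    moreover have "w (e + 7) = w 0" by (simp add: w_def face_def)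
    ultimately have "snd (w i) = snd (w 0)"
      by (rule gedges_odd_closed_walk(2)) (use even_e ji in auto)
    then show ?thesis by (simp add: w_def ji face_def)
  qed
  define F where "F v = fst (\<phi> (v, a, s))" for v
  have "F v = v"
  proof (rule wheel_rigid[OF even_e _ v])
    fix v1 v2 assume e12: "(v1, v2) \<in> wheel e"
    have "snd (\<phi> (v1, a, s)) = snd (\<phi> (v2, a, s))"
      using piece[of v1] piece[of v2] wheel_bound[OF e12] by metis
    then show "(F v1, F v2) \<in> wheel e"
      using hom[OF hard[OF e12]] unfolding F_def
      by (cases "\<phi> (v1, a, s)"; cases "\<phi> (v2, a, s)") (auto simp: gedges_def split: if_splits)
  qed
  then show "\<phi> (v, a, s) = (v, snd (\<phi> (0, a, s)))" using piece[OF v] unfolding F_def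
    by (metis prod.collapse)
qed

lemma mod5_reach:
  assumes "r < (5 :: nat)" shows "\<exists>i. (l + i) mod 5 = r"
proof (intro exI)
  have "l + (4 * l + r) = 5 * l + r" by simp
  then show "(l + (4 * l + r)) mod 5 = r" using assms by (simp only: mod_mult_self4 mod_less)
qed

text \<open>The second alternative is the case that the two sides are exchanged.\<close>

definition preserved :: "('a \<times> 'a \<times> 'a \<times> nat \<Rightarrow> 'a \<times> 'a \<times> 'a \<times> nat \<Rightarrow> bool) \<Rightarrow>
    (('a \<times> 'a \<times> 'a \<times> nat) \<times> bool \<Rightarrow> ('a \<times> 'a \<times> 'a \<times> nat) \<times> bool) \<Rightarrow> bool" where
  "preserved R \<sigma> \<longleftrightarrow> (\<forall>a\<in>cells. \<forall>b\<in>cells. R a b \<longrightarrow>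
     (\<not> snd (\<sigma> (a, False)) \<and> snd (\<sigma> (b, True)) \<and> R (fst (\<sigma> (a, False))) (fst (\<sigma> (b, True))) \<or>
      snd (\<sigma> (a, False)) \<and> \<not> snd (\<sigma> (b, True)) \<and> R (fst (\<sigma> (b, True))) (fst (\<sigma> (a, False)))))"

text \<open>An image pair not related by \<open>p\<close> would be linked in both
  directions.\<close>

lemma preserved_fun:
  assumes "preserved (\<lambda>a b. link a b \<or> b = p a) \<sigma>" "preserved (\<lambda>a b. link b a \<or> b = p a) \<sigma>"
  shows "preserved (\<lambda>a b. b = p a) \<sigma>"
  unfolding preserved_def
proof (intro ballI impI)
  fix a b assume ab: "a \<in> cells" "b \<in> cells" "b = p a"
  let ?A = "fst (\<sigma> (a, False))" and ?B = "fst (\<sigma> (b, True))"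
  note 1 = assms(1)[unfolded preserved_def, rule_format, OF ab(1,2) disjI2[OF ab(3)]]
  note 2 = assms(2)[unfolded preserved_def, rule_format, OF ab(1,2) disjI2[OF ab(3)]]
  show "\<not> snd (\<sigma> (a, False)) \<and> snd (\<sigma> (b, True)) \<and> ?B = p ?A \<or>
    snd (\<sigma> (a, False)) \<and> \<not> snd (\<sigma> (b, True)) \<and> ?A = p ?B"
    using 1 2 link_asym[of ?A ?B] by argo
qed

lemma soft_colours:
  "soft 0 = link" "soft 2 = (\<lambda>a b. link a b \<or> b = step a)" "soft 3 = (\<lambda>a b. link b a \<or> b = step a)"
  "soft 4 = (\<lambda>a b. link a b \<or> b = twist a)" "soft (e + 6) = (\<lambda>a b. link b a \<or> b = twist a)"
  "soft (e + 7) = (\<lambda>a b. link b a \<or> b = a)" "soft (2 * e + 9) = (\<lambda>a b. link a b \<or> b = a)"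
  unfolding soft_def by simp_all

lemma endo_is_act:
  assumes "\<phi> \<in> gverts \<rightarrow> gverts" and hom: "\<And>x y. (x, y) \<in> gedges \<Longrightarrow> (\<phi> x, \<phi> y) \<in> gedges"
  shows "\<exists>f\<in>carrier M. \<forall>x\<in>gverts. \<phi> x = act f x"
proof -
  obtain \<sigma> where \<sigma>: "\<And>v a s. v < 3 * e + 13 \<Longrightarrow> a \<in> cells \<Longrightarrow> \<phi> (v, a, s) = (v, \<sigma> (a, s))"
    using endo_fixes_wheel[OF assms] by blast
  have \<sigma>_cells: "fst (\<sigma> (a, s)) \<in> cells" if "a \<in> cells" for a s
  proof -
    have "(0, a, s) \<in> gverts" using that by (simp add: gverts_def)
    then have "\<phi> (0, a, s) \<in> gverts" using assms(1) by blast
    then show ?thesis using \<sigma>[of 0 a s] that by (cases "\<sigma> (a, s)") (simp add: gverts_def)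
  qed
  have pres: "preserved (soft v) \<sigma>" if "v < 3 * e + 13" for v
    unfolding preserved_def
  proof (intro ballI impI)
    fix a b assume ab: "a \<in> cells" "b \<in> cells" "soft v a b"
    then have "((v, a, False), (v, b, True)) \<in> gedges" using that
      by (simp add: gedges_def gverts_def)
    from hom[OF this] have "((v, \<sigma> (a, False)), (v, \<sigma> (b, True))) \<in> gedges"
      using \<sigma> that ab by simp
    then show "\<not> snd (\<sigma> (a, False)) \<and> snd (\<sigma> (b, True)) \<and> soft v (fst (\<sigma> (a, False))) (fst (\<sigma> (b, True))) \<or>
      snd (\<sigma> (a, False)) \<and> \<not> snd (\<sigma> (b, True)) \<and> soft v (fst (\<sigma> (b, True))) (fst (\<sigma> (a, False)))"
      by (cases "\<sigma> (a, False)"; cases "\<sigma> (b, True)") (auto simp: gedges_def wheel_irrefl split: if_splits)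
  qed
  have P: "preserved link \<sigma>" "preserved (\<lambda>a b. b = step a) \<sigma>" "preserved (\<lambda>a b. b = twist a) \<sigma>" "preserved (\<lambda>a b. b = a) \<sigma>"
    using pres[of 0] pres[of 2] pres[of 3] pres[of 4] pres[of "e + 6"] pres[of "e + 7"] pres[of "2 * e + 9"]
    unfolding soft_colours by (auto intro: preserved_fun)
  \<comment> \<open>\<open>t\<close> is the induced map on cells, and \<open>B a\<close> says that
    the copy of \<open>a\<close> on side \<open>False\<close> changes sides. Since equality is
    preserved, side \<open>True\<close> follows the same cell map with the opposite side.\<close>
  define t where "t a = fst (\<sigma> (a, False))" for a
  define B where "B a = snd (\<sigma> (a, False))" for a
  have t_cells: "t a \<in> cells" if "a \<in> cells" for a using \<sigma>_cells[OF that]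
    by (simp add: t_def)
  have top: "fst (\<sigma> (a, True)) = t a" "snd (\<sigma> (a, True)) = (\<not> B a)"
    if "a \<in> cells" for a
    using P(4)[unfolded preserved_def, rule_format, OF that that refl] by (auto simp: t_def B_def)
  have fn: "\<not> B a \<and> \<not> B (p a) \<and> t (p a) = p (t a) \<or> B a \<and> B (p a) \<and> t a = p (t (p a))"
    if "preserved (\<lambda>a b. b = p a) \<sigma>" "a \<in> cells" "p a \<in> cells" for p a
    using that(1)[unfolded preserved_def, rule_format, OF that(2,3) refl] top[OF that(3)]
    by (auto simp: t_def[of a, symmetric] B_def[of a, symmetric])
  have st: "\<not> B a \<and> \<not> B (step a) \<and> t (step a) = step (t a) \<or> B a \<and> B (step a) \<and> t a = step (t (step a))"
    if "a \<in> cells" for a by (rule fn[OF P(2) that step_cells[OF that]])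
  have twists: "\<not> B a \<and> \<not> B (twist a) \<and> t (twist a) = twist (t a) \<or> B a \<and> B (twist a) \<and> t a = twist (t (twist a))"
    if "a \<in> cells" for a by (rule fn[OF P(3) that twist_cells[OF that]])
  define blk where "blk = (\<lambda>(x :: 'a, y :: 'a, m :: 'a, l :: nat). (x, y, m))"
  have blk_step: "blk (step a) = blk a" for a by (cases a) (simp add: blk_def step_def)
  have iter: "(step ^^ i) (x, y, m, l) = (x, y, m, (next_label q (y = x \<otimes> m) ^^ i) l)" for i x y m l
    by (induction i) (auto simp: step_def)
  have iter_cells: "(step ^^ i) a \<in> cells" if "a \<in> cells" for i a
    using that by (induction i) (auto intro: step_cells)
  have orbit: "blk (t ((step ^^ i) a)) = blk (t a) \<and> B ((step ^^ i) a) = B a"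
    if "a \<in> cells" for i a
  proof (induction i)
    case (Suc i)
    then show ?case using st[OF iter_cells[OF that, of i]] blk_step by (metis funpow.simps(2) o_apply)
  qed simp
  \<comment> \<open>On one orbit of \<open>step\<close> the image triple and the side are constant.
    So \<open>t\<close> becomes a map \<open>S\<close> of labels to which \<open>label_rigid\<close>
    applies, with \<open>B\<close> as its reversal flag.\<close>
  have main: "\<not> B (x, y, m, l) \<and> (\<exists>x' y'. t (x, y, m, l) = (x', y', m, fold_label q (y = x \<otimes> m) (y' = x' \<otimes> m) l) \<and>
      (y = x \<otimes> m \<longrightarrow> y' = x' \<otimes> m))"
    if a: "(x, y, m, l) \<in> cells" for x y m l
  proof -
    define \<mu> where "\<mu> = (y = x \<otimes> m)"
    obtain x' y' m' l' where ta: "t (x, y, m, l) = (x', y', m', l')" by (cases "t (x, y, m, l)")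
    have M: "m \<in> carrier M" "m' \<in> carrier M" and l: "l < 3 * q"
      using a t_cells[OF a] ta by (auto simp: cells_def)
    define S where "S k = label_of (t (x, y, m, k))" for k
    have comp: "(x, y, m, k) \<in> cells \<and> blk (t (x, y, m, k)) = (x', y', m') \<and> B (x, y, m, k) = B (x, y, m, l)"
      if k: "k < 3 * q" "orbit_start q \<mu> k = orbit_start q \<mu> l" for k
    proof -
      \<comment> \<open>Steps that complete the orbit from \<open>l\<close> to its start and then
        lead on to \<open>k\<close>.\<close>
      define i where "i = (k - orbit_start q \<mu> k) + (orbit_size q \<mu> l - (l - orbit_start q \<mu> l))"
      have orbit_size: "orbit_size q \<mu> k = orbit_size q \<mu> l" using k l
        by (auto simp: orbit_size_def orbit_start_def split: if_splits)
      have "(next_label q \<mu> ^^ i) l = k"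
      proof -
        have "l - orbit_start q \<mu> l + i = (k - orbit_start q \<mu> k) + orbit_size q \<mu> l"
          using orbit_start_le[OF l, of \<mu>] by (simp add: i_def)
        moreover have "(k - orbit_start q \<mu> k) mod orbit_size q \<mu> l = k - orbit_start q \<mu> k"
          using orbit_start_le(2)[OF k(1), of \<mu>] orbit_size by simp
        ultimately have "(next_label q \<mu> ^^ i) l = orbit_start q \<mu> k + (k - orbit_start q \<mu> k)" using next_label_iter[OF l, of i \<mu>] k(2) by simp
        then show ?thesis using orbit_start_le(1)[OF k(1), of \<mu>] by simp
      qed
      then have "(step ^^ i) (x, y, m, l) = (x, y, m, k)" by (simp add: iter \<mu>_def)
      then show ?thesis using orbit[OF a, of i] iter_cells[OF a, of i] ta by (simp add: blk_def)
    qed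
    have tS: "t (x, y, m, k) = (x', y', m', S k)"
      if "k < 3 * q" "orbit_start q \<mu> k = orbit_start q \<mu> l" for k
      using comp[OF that] by (cases "t (x, y, m, k)") (auto simp: blk_def S_def label_of_def)
    have "\<not> B (x, y, m, l) \<and> d m = d m' \<and> (\<mu> \<longrightarrow> (y' = x' \<otimes> m')) \<and> S l = fold_label q \<mu> (y' = x' \<otimes> m') l"
    proof (rule label_rigid[OF d_ge[OF M(1)] d_ge[OF M(2)] _ l])
      show "5 * d m + 5 * d m' + 10 < q" using d_le[OF M] by (simp add: q_def)
      fix k assume k: "k < 3 * q" "orbit_start q \<mu> k = orbit_start q \<mu> l"
      note c = comp[OF k] and e1 = tS[OF k]
      have n: "next_label q \<mu> k < 3 * q" "orbit_start q \<mu> (next_label q \<mu> k) = orbit_start q \<mu> l" using next_label_range[OF k(1), of \<mu>] k(2) by auto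
      have w: "twist_label q (d m) \<mu> k < 3 * q" "orbit_start q \<mu> (twist_label q (d m) \<mu> k) = orbit_start q \<mu> l"
        using twist_label_range_mod5[OF d_ge[OF M(1)] d_less[OF M(1)] q_def k(1), of \<mu>] k(2) by auto
      have s1: "step (x, y, m, k) = (x, y, m, next_label q \<mu> k)" "twist (x, y, m, k) = (x, y, m, twist_label q (d m) \<mu> k)"
        by (simp_all add: step_def twist_def \<mu>_def)
      have s2: "step (x', y', m', z) = (x', y', m', next_label q (y' = x' \<otimes> m') z)"
        "twist (x', y', m', z) = (x', y', m', twist_label q (d m') (y' = x' \<otimes> m') z)" for z
        by (simp_all add: step_def twist_def)
      have "t (x, y, m, k) \<in> cells" using c t_cells by blast
      then show "S k < 3 * q" by (simp add: e1 cells_def)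
      have ck: "(x, y, m, k) \<in> cells" "B (x, y, m, k) = B (x, y, m, l)" using c by blast+
      note 1 = st[OF ck(1), unfolded s1 tS[OF n] tS[OF w] e1 s2 ck(2) prod.inject]
      note 2 = twists[OF ck(1), unfolded s1 tS[OF n] tS[OF w] e1 s2 ck(2) prod.inject]
      show "S (next_label q \<mu> k) = next_label q (y' = x' \<otimes> m') (S k) \<and> S (twist_label q (d m) \<mu> k) = twist_label q (d m') (y' = x' \<otimes> m') (S k)"
        if "\<not> B (x, y, m, l)" using 1 2 that by argo
      show "S k = next_label q (y' = x' \<otimes> m') (S (next_label q \<mu> k)) \<and> S k = twist_label q (d m') (y' = x' \<otimes> m') (S (twist_label q (d m) \<mu> k))"
        if "B (x, y, m, l)" using 1 2 that by argo
    qed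
    moreover from this have "m = m'" using inj_d M by (auto dest: inj_onD)
    ultimately show ?thesis using tS[OF l refl] by (auto simp: \<mu>_def)
  qed
  define X Y where "X a = fst (t a)" and "Y a = fst (snd (t a))" for a
  have lk: "X b = Y a" if "link a b" "a \<in> cells" "b \<in> cells" for a b
  proof -
    have nb: "\<not> B a" "\<not> B b" using main that by (cases a; cases b; blast)+
    have "link (t a) (t b)"
      using P(1)[unfolded preserved_def, rule_format, OF that(2,3,1)] top[OF that(3)] nb
      by (simp add: t_def[of a, symmetric] B_def[of a, symmetric])
    then show ?thesis by (cases "t a"; cases "t b") (simp add: link_def X_def Y_def)
  qed
  \<comment> \<open>Iterating \<open>step\<close> reaches every residue modulo 5 without changing
    the image triple, so a label fit for a link is always available.\<close>
  have move: "\<exists>l'. (x, y, m, l') \<in> cells \<and> l' mod 5 = r \<and> X (x, y, m, l') = X (x, y, m, l) \<and> Y (x, y, m, l') = Y (x, y, m, l)"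
    if a: "(x, y, m, l) \<in> cells" and "r < 5" for x y m l r
  proof -
    have "label_of ((step ^^ i) (x, y, m, l)) mod 5 = (l + i) mod 5" for i
    proof (induction i)
      case (Suc i)
      have "label_of (step ((step ^^ i) (x, y, m, l))) mod 5 = (label_of ((step ^^ i) (x, y, m, l)) + 1) mod 5"
        using step_label_of[OF iter_cells[OF a]] .
      also have "\<dots> = (l + i + 1) mod 5" using Suc by (rule mod_add_cong) simp
      finally show ?case by (simp add: add.assoc)
    qed (simp add: label_of_def)
    moreover obtain i where "(l + i) mod 5 = r" using mod5_reach[OF \<open>r < 5\<close>] by blast
    ultimately have "label_of ((step ^^ i) (x, y, m, l)) mod 5 = r" by simp
    moreover have "blk (t ((step ^^ i) (x, y, m, l))) = blk (t (x, y, m, l))" using orbit[OF a] by blast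
    moreover have "X b = fst (blk (t b))" "Y b = fst (snd (blk (t b)))" for b
      by (cases "t b"; simp add: X_def Y_def blk_def)+
    ultimately show ?thesis using iter_cells[OF a, of i] by (auto simp: iter label_of_def)
  qed
  \<comment> \<open>\<open>h\<close> is read off at one cell for each \<open>y\<close>. Links from
    \<open>(\<one>, x, \<one>, 0)\<close> to \<open>(x, y, m, l')\<close> and from
    \<open>(x, y, m, l')\<close> to \<open>(y, \<one>, \<one>, 2)\<close> carry it to both
    coordinates of every cell.\<close>
  define h where "h y = Y (\<one>, y, \<one>, 0)" for y
  have c1: "(\<one>, y, \<one>, 0) \<in> cells" "(y, \<one>, \<one>, 2) \<in> cells"
    if "y \<in> carrier M" for y
    using that q_gt by (auto simp: cells_def)
  have Xh: "X (x, y, m, l) = h x" if a: "(x, y, m, l) \<in> cells" for x y m l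
  proof -
    obtain l' where l': "(x, y, m, l') \<in> cells" "l' mod 5 = 2" "X (x, y, m, l') = X (x, y, m, l)"
      using move[OF a, of 2] by auto
    have "x \<in> carrier M" using a by (simp add: cells_def)
    then have "X (x, y, m, l') = Y (\<one>, x, \<one>, 0)"
      using lk[OF _ c1(1) l'(1)] l'(2) by (simp add: link_def)
    then show ?thesis using l'(3) by (simp add: h_def)
  qed
  have Yh: "Y (x, y, m, l) = h y" if a: "(x, y, m, l) \<in> cells" for x y m l
  proof -
    obtain l' where l': "(x, y, m, l') \<in> cells" "l' mod 5 = 0" "Y (x, y, m, l') = Y (x, y, m, l)"
      using move[OF a, of 0] by auto
    have y: "y \<in> carrier M" using a by (simp add: cells_def)
    have "(l' + 2) mod 5 = (0 + 2) mod 5" using l'(2) by (intro mod_add_cong) simp_all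
    then have "link (x, y, m, l') (y, \<one>, \<one>, 2)" by (simp add: link_def)
    from lk[OF this l'(1) c1(2)[OF y]] show ?thesis using l'(3) Xh[OF c1(2)[OF y]] by simp
  qed
  define f where "f = h \<one>"
  have h_carrier: "h x \<in> carrier M" if "x \<in> carrier M" for x
    using t_cells[OF c1(1)[OF that]]
      by (cases "t (\<one>, x, \<one>, 0)") (auto simp: h_def Y_def cells_def)
  have f: "f \<in> carrier M" using h_carrier by (simp add: f_def)
  have hf: "h x = f \<otimes> x" if x: "x \<in> carrier M" for x
  proof -
    \<comment> \<open>This cell is marked because \<open>x = \<one> \<otimes> x\<close>. Its image
      is therefore marked, which yields \<open>h x = h \<one> \<otimes> x\<close>.\<close>
    have c: "(\<one>, x, x, 0) \<in> cells" using x q_gt by (simp add: cells_def)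
    obtain x' y' where "t (\<one>, x, x, 0) = (x', y', x, fold_label q (x = \<one> \<otimes> x) (y' = x' \<otimes> x) 0)" "x = \<one> \<otimes> x \<longrightarrow> y' = x' \<otimes> x"
      using main[OF c] by blast
    then show ?thesis using Xh[OF c] Yh[OF c] x by (simp add: X_def Y_def f_def)
  qed
  have shift_t: "t a = shift f a \<and> \<not> B a" if a: "a \<in> cells" for a
  proof -
    obtain x y m l where xyz: "a = (x, y, m, l)" by (cases a)
    have xy: "x \<in> carrier M" "y \<in> carrier M" using a by (simp_all add: xyz cells_def)
    obtain x' y' where t: "t (x, y, m, l) = (x', y', m, fold_label q (y = x \<otimes> m) (y' = x' \<otimes> m) l)" and "\<not> B (x, y, m, l)"
      using main a unfolding xyz by blast
    moreover have "x' = f \<otimes> x" "y' = f \<otimes> y"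
      using Xh[of x y m l] Yh[of x y m l] a t hf xy unfolding xyz by (simp_all add: X_def Y_def)
    ultimately show ?thesis by (simp add: xyz shift_def)
  qed
  have "\<phi> x = act f x" if x: "x \<in> gverts" for x
  proof -
    obtain v a s where v: "x = (v, a, s)" by (cases x)
    have va: "v < 3 * e + 13" "a \<in> cells" using x by (auto simp: v gverts_def)
    have "\<sigma> (a, s) = (shift f a, s)"
      using shift_t[OF va(2)] top[OF va(2)] by (cases s) (auto simp: prod_eq_iff t_def[of a] B_def[of a])
    then show ?thesis using \<sigma>[OF va] by (simp add: v act_def)
  qed
  then show ?thesis using f by blast
qed

end

section \<open>Infinitely many graphs\<close>

theorem theorem1p3:
  fixes M :: "('a, 'm) monoid_scheme" and g :: nat
  assumes "monoid M" and "finite (carrier M)"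
    and "odd g" and "g \<ge> 7"
  shows "\<exists>\<G> :: nat pair_pre_digraph set.
    infinite \<G> \<and>
    (\<forall>G \<in> \<G>. \<forall>H \<in> \<G>. digraph_iso (with_proj G) (with_proj H) \<longrightarrow> G = H) \<and>
    (\<forall>G \<in> \<G>. pair_graph G \<and> regular_graph G \<and> odd_girth G = enat g \<and> End_monoid G \<cong> M)"
proof -
  interpret monoid M by fact
  define e where "e = g - 7"
  have g: "g = e + 7" "even e" using assms(3,4) by (auto simp: e_def)
  obtain n i where ni: "i ` carrier M = {j. j < (n :: nat)}" "inj_on i (carrier M)"
    using finite_imp_inj_to_nat_seg[OF assms(2)] by blast
  \<comment> \<open>The summand 3 gives \<open>d_ge\<close>. As \<open>d m \<le> n + 2\<close>,
    already the value \<open>2 * n + 9\<close> of \<open>u\<close> satisfies \<open>d_le\<close>;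
    \<open>k\<close> makes the graphs grow.\<close>
  define d where "d m = i m + 3" for m
  define u where "u k = 2 * n + 9 + k" for k
  have "monoid_cells M e (u k) d" for k
  proof
    fix m m' assume "m \<in> carrier M" "m' \<in> carrier M"
    then have "i m < n" "i m' < n" using ni(1) by blast+
    then show "5 * d m + 5 * d m' + 10 < 5 * u k" by (simp add: d_def u_def)
  qed (use assms g ni in \<open>auto simp: d_def inj_on_def\<close>)
  then have "\<exists>G :: nat pair_pre_digraph. pair_graph G \<and> regular_graph G \<and> odd_girth G = enat g \<and>
    End_monoid G \<cong> M \<and> card (pverts G) = (3 * e + 13) * (card (carrier M) ^ 3 * (15 * u k)) * 2" for k
  proof -
    interpret monoid_cells M e "u k" d by fact
    show ?thesis
      unfolding g(1) card_gverts[symmetric]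
    proof (rule nat_graph_exists[OF monoid_axioms finite_gverts gedges_sub sym_gedges irrefl_gedges, where act = act])
      show "odd (e + 7)" using g(2) by simp
      show "card (gedges `` {v}) = base_degree + 3" if "v \<in> gverts" for v
        using gedges_degree[OF that] .
      show "e + 7 \<le> m" if "is_walk gedges m w" "w m = w 0" "odd m" for m w
        using gedges_odd_closed_walk(1)[OF that] .
      show "is_walk gedges (e + 7) (\<lambda>i. (face e 0 i, (\<one>\<^bsub>M\<^esub>, \<one>\<^bsub>M\<^esub>, \<one>\<^bsub>M\<^esub>, 0), False))"
        "(face e 0 (e + 7), (\<one>\<^bsub>M\<^esub>, \<one>\<^bsub>M\<^esub>, \<one>\<^bsub>M\<^esub>, 0 :: nat), False) = (face e 0 0, (\<one>\<^bsub>M\<^esub>, \<one>\<^bsub>M\<^esub>, \<one>\<^bsub>M\<^esub>, 0), False)"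
        "inj_on (\<lambda>i. (face e 0 i, (\<one>\<^bsub>M\<^esub>, \<one>\<^bsub>M\<^esub>, \<one>\<^bsub>M\<^esub>, 0 :: nat), False)) {..<e + 7}"
        using girth_cycle_exists by blast+
      show "act f v \<in> gverts" if "f \<in> carrier M" "v \<in> gverts" for f v
        using act_verts[OF that] .
      show "(act f x, act f y) \<in> gedges" if "f \<in> carrier M" "(x, y) \<in> gedges" for f x y
        using act_edges[OF that] .
      show "act (f \<otimes>\<^bsub>M\<^esub> h) v = act f (act h v)"
        if "f \<in> carrier M" "h \<in> carrier M" "v \<in> gverts" for f h v
        using act_mult[OF that] .
      show "f = h"
        if "f \<in> carrier M" "h \<in> carrier M" "\<And>v. v \<in> gverts \<Longrightarrow> act f v = act h v" for f h
        using act_inj[OF that] .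
      show "\<exists>f\<in>carrier M. \<forall>v\<in>gverts. \<phi> v = act f v"
        if "\<phi> \<in> gverts \<rightarrow> gverts" "\<And>x y. (x, y) \<in> gedges \<Longrightarrow> (\<phi> x, \<phi> y) \<in> gedges" for \<phi>
        using endo_is_act[OF that] .
    qed
  qed
  then obtain G :: "nat \<Rightarrow> nat pair_pre_digraph" where G: "\<And>k. pair_graph (G k) \<and> regular_graph (G k) \<and>
    odd_girth (G k) = enat g \<and> End_monoid (G k) \<cong> M" and
    card_G: "\<And>k. card (pverts (G k)) = (3 * e + 13) * (card (carrier M) ^ 3 * (15 * u k)) * 2"
      by metis
  have "0 < card (carrier M)" using assms(2) one_closed by (auto simp: card_gt_0_iff)
  \<comment> \<open>The carrier is nonempty, so the number of vertices grows strictly with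
    \<open>k\<close>; being an isomorphism invariant, it separates the graphs.\<close>
  then have inj: "k = k'" if "card (pverts (G k)) = card (pverts (G k'))" for k k'
    using that by (simp add: card_G u_def)
  have iso: "card (pverts A) = card (pverts B)"
    if "digraph_iso (with_proj A) (with_proj B)" for A B :: "nat pair_pre_digraph"
  proof -
    obtain \<psi> where "pre_digraph.digraph_isomorphism (with_proj A) \<psi>" "with_proj B = app_iso \<psi> (with_proj A)"
      using \<open>digraph_iso _ _\<close> by (auto simp: digraph_iso_def)
    then have "verts (with_proj B) = iso_verts \<psi> ` verts (with_proj A)" "inj_on (iso_verts \<psi>) (verts (with_proj A))"
      by (auto simp: pre_digraph.digraph_isomorphism_def)
    then show ?thesis by (simp add: card_image with_proj_def)
  qed
  show ?thesis
  proof (intro exI[of _ "range G"] conjI ballI impI)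
    have "inj G" using inj by (metis injI)
    then show "infinite (range G)" by (simp add: finite_image_iff)
  next
    fix A B assume "A \<in> range G" "B \<in> range G" "digraph_iso (with_proj A) (with_proj B)"
    then show "A = B" using inj iso by blast
  qed (use G in auto)
qed

end
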